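(* Let $\varepsilon=\varepsilon(x)$ and $\mu=\mu(x)$ be either complex-valued functions with a positive real part or real-valued positive-definite $3\times 3$ matrix functions, and suppose that their restrictions $\varepsilon_\pm,\mu_\pm$ to $\Omega_\pm$ belong to $W^{1,\infty}(\Omega_\pm)$. Then the following boundary value problem for $u=(E,\alpha,H,\beta)$, with $E,H$ $\mathbb{C}^3$-valued, $\alpha,\beta$ scalar, and all components in $H^1(\Omega\setminus\Gamma)$, is elliptic: $$\operatorname{curl}E+\mu\nabla\alpha=\mathrm{i}\omega\mu H,\qquad \operatorname{curl}H+\varepsilon\nabla\beta=-\mathrm{i}\omega\varepsilon E,\qquad x\in\Omega\setminus\Gamma,$$ $$-\operatorname{div}(\varepsilon E)=0,\qquad -\operatorname{div}(\mu H)=0,\qquad x\in\Omega\setminus\Gamma,$$ $$[\![E_\tau]\!]=E_\tau^\Gamma,\qquad [\![n\cdot\varepsilon E]\!]=D_\nu^\Gamma,\qquad [\![\beta]\!]=\beta^\Gamma,\qquad x\in\Gamma,$$ $$[\![H_\tau]\!]=H_\tau^\Gamma,\qquad [\![n\cdot\mu H]\!]=B_\nu^\Gamma,\qquad [\![\alpha]\!]=\alpha^\Gamma,\qquad x\in\Gamma,$$ $$E_\tau=E_\tau^0,\qquad n\cdot\mu H=B_\nu^0,\qquad \beta=\beta^0,\qquad x\in\partial\Omega,$$ where the prescribed boundary data belong to the (vector or scalar) spaces $H^{1/2}(\Gamma)$ and $H^{1/2}(\partial\Omega)$, respectively.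
   Context: Geometry: $\Omega\subset\mathbb{R}^3$ is a bounded domain, $\Omega_-$ is a subdomain located strictly inside $\Omega$, $\Omega_+=\Omega\setminus\overline{\Omega_-}$, $\Gamma=\partial\Omega_-$; the surfaces $\Gamma$ and $\partial\Omega$ are Lipschitz. $n$ is the unit normal to $\Gamma$ and to $\partial\Omega$, exterior to $\Omega_-$ and to $\Omega$, respectively. $\omega\in\mathbb{C}$ is a parameter (frequency). Notation: $H^s$ denotes Sobolev spaces of scalar or vector functions; $H^1(\Omega\setminus\Gamma)$ consists of functions on $\Omega$ whose restrictions to $\Omega_\pm$ belong to $H^1(\Omega_\pm)$. For a vector field $F$, $F_\tau=n\times F$. $[\![u]\!]$ is the jump across $\Gamma$: the limiting value from $\Omega_+$ minus the limiting value from $\Omega_-$. $W^{1,\infty}(\Omega_\pm)$ consists of (matrix-valued) functions whose entries and first derivatives are essentially bounded. Ellipticity of the boundary value problem means: (1) the system of equations is elliptic: for every point $x\in\overline\Omega$, the characteristic matrix (principal symbol) obtained by freezing the coefficients at $x$ and omitting lower-order terms is invertible for every nonzero real dual variable $\sigma\in\mathbb{R}^3$; (2) the boundary conditions satisfy the Shapiro–Lopatinsky condition at each point $x_0$ of $\partial\Omega$ and of $\Gamma$: introduce local coordinates in which the boundary near $x_0$ is flat, freeze the coefficients in the equations and boundary conditions at $x_0$, drop the lower-order terms, and take homogeneous right-hand sides; then the resulting problem has only the trivial solution in the class of functions of the form $e^{\mathrm{i}x'\cdot\sigma'}v$, where $x'$ are the two tangential variables, $\sigma'$ is the corresponding (nonzero,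 real) dual vector, and the vector function $v$ depends only on the normal variable and decays exponentially at infinity. For $x_0\in\partial\Omega$ the resulting problem is posed in a half-space; for $x_0\in\Gamma$ it is a pair of problems in the two half-spaces with common boundary plane $\Gamma'$, coupled by the jump conditions on $\Gamma'$, and decay is required as the distance from $\Gamma'$ tends to infinity on both sides.
   Formalization: Positivity of ε and μ is required of their limiting values on the closures of Ω₊ and Ω₋ too (else ε = dist(x,∂Ω) is a counterexample), and the Shapiro–Lopatinsky condition is asserted at those points of ∂Ω and Γ where the unit normal exists. *)

theory Defs
  imports "HOL-Analysis.Analysis"
begin

type_synonym R3 = "real^3"

definition dpartial :: "3 \<Rightarrow> (R3 \<Rightarrow> 'a::real_normed_vector) \<Rightarrow> R3 \<Rightarrow> 'a" where
  "dpartial j f x = vector_derivative (\<lambda>t. f (x + t *\<^sub>R axis j 1)) (at 0)"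


section \<open>Domains with Lipschitz boundary\<close>

definition lift3 :: "real^2 \<Rightarrow> real \<Rightarrow> R3" where
  "lift3 y s = vector [y$1, y$2, s]"

text \<open>In the orthonormal coordinates \<open>(y, s)\<close> given by \<open>x = x0 + T (lift3 y s)\<close>, the set \<open>D\<close>
  is the subgraph of the Lipschitz function \<open>\<phi>\<close> inside the cylinder
  \<open>norm y < r, \<bar>s\<bar> < h\<close> around the boundary point \<open>x0\<close>.\<close>

definition lipschitz_chart ::
    "R3 set \<Rightarrow> R3 \<Rightarrow> (R3 \<Rightarrow> R3) \<Rightarrow> (real^2 \<Rightarrow> real) \<Rightarrow> real \<Rightarrow> real \<Rightarrow> bool" where
  "lipschitz_chart D x0 T \<phi> r h \<longleftrightarrow>
     orthogonal_transformation T \<and> 0 < r \<and> 0 < h \<and>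
     (\<exists>C. C-lipschitz_on UNIV \<phi>) \<and> \<phi> 0 = 0 \<and>
     (\<forall>y s. norm y < r \<and> \<bar>s\<bar> < h \<longrightarrow>
        \<bar>\<phi> y\<bar> < h \<and> (x0 + T (lift3 y s) \<in> D \<longleftrightarrow> s < \<phi> y))"

definition lipschitz_boundary :: "R3 set \<Rightarrow> bool" where
  "lipschitz_boundary D \<longleftrightarrow> (\<forall>x0\<in>frontier D. \<exists>T \<phi> r h. lipschitz_chart D x0 T \<phi> r h)"

text \<open>The exterior unit normal of a Lipschitz surface exists exactly at those points (almost all,
  by Rademacher's theorem) at which the graph function is differentiable.\<close>

definition exterior_normal :: "R3 set \<Rightarrow> R3 \<Rightarrow> R3 \<Rightarrow> bool" where
  "exterior_normal D x0 n \<longleftrightarrow>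
     (\<exists>T \<phi> r h g. lipschitz_chart D x0 T \<phi> r h \<and>
        (\<phi> has_derivative (\<lambda>y. g \<bullet> y)) (at 0) \<and>
        n = (1 / sqrt (1 + (norm g)\<^sup>2)) *\<^sub>R T (lift3 (- g) 1))"

definition bounded_domain :: "R3 set \<Rightarrow> bool" where
  "bounded_domain D \<longleftrightarrow> open D \<and> connected D \<and> D \<noteq> {} \<and> bounded D"


section \<open>Sobolev spaces\<close>

definition test_function :: "R3 set \<Rightarrow> (R3 \<Rightarrow> real) \<Rightarrow> bool" where
  "test_function D \<phi> \<longleftrightarrow>
     (\<forall>js. foldr dpartial js \<phi> differentiable_on UNIV) \<and>
     compact (closure {x. \<phi> x \<noteq> 0}) \<and> closure {x. \<phi> x \<noteq> 0} \<subseteq> D"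

definition weak_partial ::
    "R3 set \<Rightarrow> 3 \<Rightarrow> (R3 \<Rightarrow> 'a::euclidean_space) \<Rightarrow> (R3 \<Rightarrow> 'a) \<Rightarrow> bool" where
  "weak_partial D j f g \<longleftrightarrow>
     (\<forall>\<phi>. test_function D \<phi> \<longrightarrow>
        integral\<^sup>L (lebesgue_on D) (\<lambda>x. \<phi> x *\<^sub>R g x) =
        - integral\<^sup>L (lebesgue_on D) (\<lambda>x. dpartial j \<phi> x *\<^sub>R f x))"

definition L2_space :: "R3 set \<Rightarrow> (R3 \<Rightarrow> 'a::euclidean_space) set" where
  "L2_space D = {f \<in> borel_measurable (lebesgue_on D).
                   integrable (lebesgue_on D) (\<lambda>x. (norm (f x))\<^sup>2)}"

definition Linf_space :: "R3 set \<Rightarrow> (R3 \<Rightarrow> 'a::euclidean_space) set" where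
  "Linf_space D = {f \<in> borel_measurable (lebesgue_on D).
                   \<exists>C. AE x in lebesgue_on D. norm (f x) \<le> C}"

definition H1_space :: "R3 set \<Rightarrow> (R3 \<Rightarrow> 'a::euclidean_space) set" where
  "H1_space D = {f \<in> L2_space D. \<forall>j. \<exists>g\<in>L2_space D. weak_partial D j f g}"

definition W1inf_space :: "R3 set \<Rightarrow> (R3 \<Rightarrow> 'a::euclidean_space) set" where
  "W1inf_space D = {f \<in> Linf_space D. \<forall>j. \<exists>g\<in>Linf_space D. weak_partial D j f g}"

text \<open>\<open>H\<^sup>1\<^sup>/\<^sup>2\<close> on the boundary of \<open>D\<close>: in suitable Lipschitz charts, square integrability and the
  Gagliardo (Slobodeckij) seminorm of order \<open>1/2\<close> in dimension \<open>2\<close>, whence the exponent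
  \<open>2 + 2 * (1/2) = 3\<close>.\<close>

definition Hhalf_boundary :: "R3 set \<Rightarrow> (R3 \<Rightarrow> 'a::euclidean_space) set" where
  "Hhalf_boundary D = {g. \<forall>x0\<in>frontier D. \<exists>T \<phi> r h. lipschitz_chart D x0 T \<phi> r h \<and>
     (let f = (\<lambda>y. g (x0 + T (lift3 y (\<phi> y)))); M = lebesgue_on (ball 0 r) in
        f \<in> borel_measurable M \<and>
        (\<integral>\<^sup>+y. ennreal ((norm (f y))\<^sup>2) \<partial>M) < \<infinity> \<and>
        (\<integral>\<^sup>+y. (\<integral>\<^sup>+z. ennreal ((norm (f y - f z))\<^sup>2 / (norm (y - z)) ^ 3) \<partial>M) \<partial>M) < \<infinity>)}"


section \<open>First-order boundary value problems with a transmission surface\<close>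

text \<open>A first-order system for \<open>u :: R3 \<Rightarrow> complex^'u\<close> whose leading terms may appear both
  inside and outside of the derivatives; keeping the two kinds separate lets \<open>div (\<epsilon> E)\<close> be
  written down without differentiating \<open>\<epsilon>\<close>. See \<open>op_apply\<close>.\<close>

record ('u::finite) fo_operator =
  cdiv :: "3 \<Rightarrow> R3 \<Rightarrow> complex^'u^'u"
  cgrad :: "3 \<Rightarrow> R3 \<Rightarrow> complex^'u^'u"
  czero :: "R3 \<Rightarrow> complex^'u^'u"

definition op_apply :: "('u::finite) fo_operator \<Rightarrow> (R3 \<Rightarrow> complex^'u) \<Rightarrow> R3 \<Rightarrow> complex^'u" where
  "op_apply L u x =
     (\<Sum>j\<in>UNIV. dpartial j (\<lambda>y. cdiv L j y *v u y) x) +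
     (\<Sum>j\<in>UNIV. cgrad L j x *v dpartial j u x) + czero L x *v u x"

text \<open>Coefficients frozen at \<open>x0\<close>, lower-order terms omitted.\<close>

definition frozen_principal :: "('u::finite) fo_operator \<Rightarrow> R3 \<Rightarrow> 'u fo_operator" where
  "frozen_principal L x0 =
     \<lparr>cdiv = (\<lambda>j _. cdiv L j x0), cgrad = (\<lambda>j _. cgrad L j x0), czero = (\<lambda>_. 0)\<rparr>"

definition principal_symbol :: "('u::finite) fo_operator \<Rightarrow> R3 \<Rightarrow> R3 \<Rightarrow> complex^'u^'u" where
  "principal_symbol L x0 \<sigma> =
     (\<chi> k l. \<Sum>j\<in>UNIV. \<i> * of_real (\<sigma>$j) * (cdiv L j x0 + cgrad L j x0)$k$l)"

text \<open>\<open>Outside\<close> stands for \<open>\<Omega>\<^sub>+\<close>, \<open>Inside\<close> for \<open>\<Omega>\<^sub>-\<close>.\<close>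

datatype side = Outside | Inside

definition region :: "R3 set \<Rightarrow> R3 set \<Rightarrow> side \<Rightarrow> R3 set" where
  "region \<Omega> \<Omega>m s = (case s of Outside \<Rightarrow> \<Omega> - closure \<Omega>m | Inside \<Rightarrow> \<Omega>m)"

text \<open>The problem of finding \<open>u\<close> in the space \<open>unknowns\<close> such that
  \<^item> \<open>op_apply (interior_op s) u = 0\<close> in \<open>region \<Omega> \<Omega>m s\<close>, for both sides \<open>s\<close>;
  \<^item> \<open>jump_op Outside x n *v u\<^sub>+ - jump_op Inside x n *v u\<^sub>- = jump_data x\<close> on \<open>\<Gamma> = frontier \<Omega>m\<close>,
    where \<open>u\<^sub>+\<close>, \<open>u\<^sub>-\<close> are the limiting values of \<open>u\<close> from the two sides;
  \<^item> \<open>boundary_op x n *v u = boundary_data x\<close> on \<open>frontier \<Omega>\<close>.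

  Here \<open>n\<close> is the unit normal at \<open>x\<close>, exterior to \<open>\<Omega>m\<close> and to \<open>\<Omega>\<close>, respectively. The coefficients
  on side \<open>s\<close> are functions on the closure of the region.\<close>

record ('u::finite, 'j::finite, 'b::finite) transmission_problem =
  outer_domain :: "R3 set"
  inner_domain :: "R3 set"
  unknowns :: "(R3 \<Rightarrow> complex^'u) set"
  interior_op :: "side \<Rightarrow> 'u fo_operator"
  jump_op :: "side \<Rightarrow> R3 \<Rightarrow> R3 \<Rightarrow> complex^'u^'j"
  boundary_op :: "R3 \<Rightarrow> R3 \<Rightarrow> complex^'u^'b"
  jump_data :: "R3 \<Rightarrow> complex^'j"
  boundary_data :: "R3 \<Rightarrow> complex^'b"

definition elliptic_system ::
    "('u::finite, 'j::finite, 'b::finite) transmission_problem \<Rightarrow> bool" where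
  "elliptic_system P \<longleftrightarrow>
     (\<forall>s. \<forall>x0 \<in> closure (region (outer_domain P) (inner_domain P) s).
        \<forall>\<sigma>. \<sigma> \<noteq> 0 \<longrightarrow> invertible (principal_symbol (interior_op P s) x0 \<sigma>))"

text \<open>With orthonormal tangential coordinates \<open>x'\<close> and dual variables \<open>\<sigma>'\<close> in the plane orthogonal
  to \<open>n\<close>, \<open>x' \<bullet> \<sigma>'\<close> equals \<open>\<sigma> \<bullet> x\<close> for the tangential vector \<open>\<sigma>\<close> representing \<open>\<sigma>'\<close>, and the
  normal coordinate is \<open>n \<bullet> x\<close>.\<close>

definition normal_mode :: "R3 \<Rightarrow> R3 \<Rightarrow> (real \<Rightarrow> complex^'u) \<Rightarrow> R3 \<Rightarrow> complex^('u::finite)" where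
  "normal_mode \<sigma> n v x = exp (\<i> * of_real (\<sigma> \<bullet> x)) *s v (n \<bullet> x)"

definition decaying_profile :: "real set \<Rightarrow> (real \<Rightarrow> complex^('u::finite)) \<Rightarrow> bool" where
  "decaying_profile I v \<longleftrightarrow> continuous_on I v \<and> v differentiable_on interior I \<and>
     (\<exists>C \<delta>. 0 < \<delta> \<and> (\<forall>t\<in>I. norm (v t) \<le> C * exp (- \<delta> * \<bar>t\<bar>)))"

definition SL_boundary ::
    "('u::finite, 'j::finite, 'b::finite) transmission_problem \<Rightarrow> R3 \<Rightarrow> R3 \<Rightarrow> bool" where
  "SL_boundary P x0 n \<longleftrightarrow>
     (\<forall>\<sigma> v. \<sigma> \<noteq> 0 \<and> \<sigma> \<bullet> n = 0 \<and> decaying_profile {..0} v \<and>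
        (\<forall>x. n \<bullet> x < 0 \<longrightarrow>
           op_apply (frozen_principal (interior_op P Outside) x0) (normal_mode \<sigma> n v) x = 0) \<and>
        (\<forall>x. n \<bullet> x = 0 \<longrightarrow> boundary_op P x0 n *v normal_mode \<sigma> n v x = 0)
      \<longrightarrow> (\<forall>t\<le>0. v t = 0))"

definition SL_interface ::
    "('u::finite, 'j::finite, 'b::finite) transmission_problem \<Rightarrow> R3 \<Rightarrow> R3 \<Rightarrow> bool" where
  "SL_interface P x0 n \<longleftrightarrow>
     (\<forall>\<sigma> vp vm. \<sigma> \<noteq> 0 \<and> \<sigma> \<bullet> n = 0 \<and>
        decaying_profile {0..} vp \<and> decaying_profile {..0} vm \<and>
        (\<forall>x. n \<bullet> x > 0 \<longrightarrow>
           op_apply (frozen_principal (interior_op P Outside) x0) (normal_mode \<sigma> n vp) x = 0) \<and>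
        (\<forall>x. n \<bullet> x < 0 \<longrightarrow>
           op_apply (frozen_principal (interior_op P Inside) x0) (normal_mode \<sigma> n vm) x = 0) \<and>
        (\<forall>x. n \<bullet> x = 0 \<longrightarrow>
           jump_op P Outside x0 n *v normal_mode \<sigma> n vp x -
           jump_op P Inside x0 n *v normal_mode \<sigma> n vm x = 0)
      \<longrightarrow> (\<forall>t\<ge>0. vp t = 0) \<and> (\<forall>t\<le>0. vm t = 0))"

definition elliptic_problem ::
    "('u::finite, 'j::finite, 'b::finite) transmission_problem \<Rightarrow> bool" where
  "elliptic_problem P \<longleftrightarrow> elliptic_system P \<and>
     (\<forall>x0\<in>frontier (outer_domain P). \<forall>n.
        exterior_normal (outer_domain P) x0 n \<longrightarrow> SL_boundary P x0 n) \<and>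
     (\<forall>x0\<in>frontier (inner_domain P). \<forall>n.
        exterior_normal (inner_domain P) x0 n \<longrightarrow> SL_interface P x0 n)"


section \<open>The extended Maxwell system\<close>

definition vjoin :: "'a^'m \<Rightarrow> 'a^'n \<Rightarrow> 'a^('m::finite + 'n::finite)" (infixr "\<Zsemi>" 65) where
  "v \<Zsemi> w = (\<chi> i. case i of Inl k \<Rightarrow> v$k | Inr k \<Rightarrow> w$k)"

definition sc :: "complex \<Rightarrow> complex^1" where
  "sc a = (\<chi> i. a)"

type_synonym em = "3 + 1 + 3 + 1"

definition em_pack ::
    "complex^3 \<Rightarrow> complex \<Rightarrow> complex^3 \<Rightarrow> complex \<Rightarrow> complex^em" where
  "em_pack E a H b = E \<Zsemi> sc a \<Zsemi> H \<Zsemi> sc b"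

definition em_E :: "complex^em \<Rightarrow> complex^3" where "em_E u = (\<chi> i. u $ Inl i)"
definition em_alpha :: "complex^em \<Rightarrow> complex" where "em_alpha u = u $ Inr (Inl 1)"
definition em_H :: "complex^em \<Rightarrow> complex^3" where "em_H u = (\<chi> i. u $ Inr (Inr (Inl i)))"
definition em_beta :: "complex^em \<Rightarrow> complex" where "em_beta u = u $ Inr (Inr (Inr 1))"

lemma em_pack_sel [simp]:
  "em_E (em_pack E a H b) = E" "em_alpha (em_pack E a H b) = a"
  "em_H (em_pack E a H b) = H" "em_beta (em_pack E a H b) = b"
  by (simp_all add: em_pack_def em_E_def em_alpha_def em_H_def em_beta_def vjoin_def sc_def
      vec_eq_iff)

definition ccross :: "complex^3 \<Rightarrow> complex^3 \<Rightarrow> complex^3" where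
  "ccross a b = vector [a$2 * b$3 - a$3 * b$2, a$3 * b$1 - a$1 * b$3, a$1 * b$2 - a$2 * b$1]"

text \<open>Bilinear, without complex conjugation.\<close>

definition cdot :: "complex^3 \<Rightarrow> complex^3 \<Rightarrow> complex" where
  "cdot a b = (\<Sum>i\<in>UNIV. a$i * b$i)"

definition cvec :: "R3 \<Rightarrow> complex^3" where
  "cvec n = (\<chi> i. of_real (n$i))"

definition cgradient :: "(R3 \<Rightarrow> complex) \<Rightarrow> R3 \<Rightarrow> complex^3" where
  "cgradient a x = (\<chi> j. dpartial j a x)"

definition ccurl :: "(R3 \<Rightarrow> complex^3) \<Rightarrow> R3 \<Rightarrow> complex^3" where
  "ccurl F x = vector
     [dpartial 2 F x $ 3 - dpartial 3 F x $ 2,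
      dpartial 3 F x $ 1 - dpartial 1 F x $ 3,
      dpartial 1 F x $ 2 - dpartial 2 F x $ 1]"

definition cdivergence :: "(R3 \<Rightarrow> complex^3) \<Rightarrow> R3 \<Rightarrow> complex" where
  "cdivergence F x = (\<Sum>j\<in>UNIV. dpartial j F x $ j)"

text \<open>The four equations are arranged in the order \<open>curl E + ...\<close>, \<open>- div (\<epsilon> E)\<close>,
  \<open>curl H + ...\<close>, \<open>- div (\<mu> H)\<close>, all terms being moved to the left-hand side. The coefficients
  come from \<open>curl F = (\<Sum>j. e\<^sub>j \<times> \<partial>\<^sub>j F)\<close>; \<open>maxwell_op_classical\<close> recovers the equations.\<close>

definition maxwell_op ::
    "complex \<Rightarrow> (R3 \<Rightarrow> complex^3^3) \<Rightarrow> (R3 \<Rightarrow> complex^3^3) \<Rightarrow> em fo_operator" where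
  "maxwell_op \<omega> \<epsilon> \<mu> = \<lparr>
     cdiv = (\<lambda>j x. matrix (\<lambda>u. em_pack
        0 (- (\<epsilon> x *v em_E u) $ j)
        0 (- (\<mu> x *v em_H u) $ j))),
     cgrad = (\<lambda>j x. matrix (\<lambda>u. em_pack
        (ccross (axis j 1) (em_E u) + \<mu> x *v (em_alpha u *s axis j 1)) 0
        (ccross (axis j 1) (em_H u) + \<epsilon> x *v (em_beta u *s axis j 1)) 0)),
     czero = (\<lambda>x. matrix (\<lambda>u. em_pack
        (- ((\<i> * \<omega>) *s (\<mu> x *v em_H u))) 0
        ((\<i> * \<omega>) *s (\<epsilon> x *v em_E u)) 0))\<rparr>"

lemma em_pack_add: "em_pack E a H b + em_pack E' a' H' b' = em_pack (E+E') (a+a') (H+H') (b+b')"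
  by (auto simp: em_pack_def vjoin_def sc_def vec_eq_iff split: sum.split)

lemma em_pack_scale: "c *s em_pack E a H b = em_pack (c *s E) (c * a) (c *s H) (c * b)"
  by (auto simp: em_pack_def vjoin_def sc_def vec_eq_iff split: sum.split)

lemma em_pack_scaleR: "r *\<^sub>R em_pack E a H b = em_pack (r *\<^sub>R E) (r *\<^sub>R a) (r *\<^sub>R H) (r *\<^sub>R b)"
  by (auto simp: em_pack_def vjoin_def sc_def vec_eq_iff split: sum.split)

lemma em_pack_sum:
  "(\<Sum>j\<in>A. em_pack (E j) (a j) (H j) (b j)) =
     em_pack (\<Sum>j\<in>A. E j) (\<Sum>j\<in>A. a j) (\<Sum>j\<in>A. H j) (\<Sum>j\<in>A. b j)"
proof (induction A rule: infinite_finite_induct)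
  case (insert x F)
  then show ?case by (simp add: em_pack_add)
qed (auto simp: em_pack_def vjoin_def sc_def vec_eq_iff split: sum.split)

lemma em_sel_lin:
  "em_E (u + v) = em_E u + em_E v" "em_H (u + v) = em_H u + em_H v"
  "em_alpha (u + v) = em_alpha u + em_alpha v" "em_beta (u + v) = em_beta u + em_beta v"
  "em_E (c *s u) = c *s em_E u" "em_H (c *s u) = c *s em_H u"
  "em_alpha (c *s u) = c * em_alpha u" "em_beta (c *s u) = c * em_beta u"
  by (simp_all add: em_E_def em_H_def em_alpha_def em_beta_def vec_eq_iff)

lemma ccross_lin:
  "ccross a (b + b') = ccross a b + ccross a b'" "ccross a (c *s b) = c *s ccross a b"
  by (simp_all add: ccross_def vec_eq_iff forall_3 algebra_simps)

lemma linear_matrix_works: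
  fixes f :: "complex^'n \<Rightarrow> complex^'m"
  assumes "\<And>u v. f (u + v) = f u + f v" "\<And>c u. f (c *s u) = c *s f u"
  shows "matrix f *v u = f u"
  by (rule matrix_works)
    (simp add: Vector_Spaces.linear_def vec.vector_space_axioms module_hom_axioms_def
      module_hom_def vec.module_axioms assms)

lemma maxwell_op_works:
  "cdiv (maxwell_op \<omega> \<epsilon> \<mu>) j x *v u =
     em_pack 0 (- (\<epsilon> x *v em_E u) $ j) 0 (- (\<mu> x *v em_H u) $ j)"
  "cgrad (maxwell_op \<omega> \<epsilon> \<mu>) j x *v u = em_pack
     (ccross (axis j 1) (em_E u) + \<mu> x *v (em_alpha u *s axis j 1)) 0
     (ccross (axis j 1) (em_H u) + \<epsilon> x *v (em_beta u *s axis j 1)) 0"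
  "czero (maxwell_op \<omega> \<epsilon> \<mu>) x *v u = em_pack
     (- ((\<i> * \<omega>) *s (\<mu> x *v em_H u))) 0 ((\<i> * \<omega>) *s (\<epsilon> x *v em_E u)) 0"
  unfolding maxwell_op_def fo_operator.select_convs
  by (subst linear_matrix_works;
      simp add: em_pack_add em_pack_scale em_sel_lin ccross_lin;
      simp add: vec_eq_iff em_pack_def vjoin_def sc_def matrix_vector_mult_def
        sum.distrib sum_distrib_left algebra_simps axis_def split: sum.split)+

lemma dpartial_works:
  assumes "f differentiable at x"
  shows "((\<lambda>t. f (x + t *\<^sub>R axis j 1)) has_vector_derivative dpartial j f x) (at 0)"
proof -
  have "(\<lambda>t::real. x + t *\<^sub>R axis j 1) differentiable at 0"
    by (intro derivative_intros)
  then have "(f \<circ> (\<lambda>t::real. x + t *\<^sub>R axis j 1)) differentiable at 0"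
    by (rule differentiable_chain_at) (use assms in simp)
  then show ?thesis
    unfolding dpartial_def by (simp add: vector_derivative_works o_def)
qed

lemma dpartial_em_pack:
  assumes "E differentiable at x" "a differentiable at x" "H differentiable at x" "b differentiable at x"
  shows "dpartial j (\<lambda>y. em_pack (E y) (a y) (H y) (b y)) x =
           em_pack (dpartial j E x) (dpartial j a x) (dpartial j H x) (dpartial j b x)"
proof -
  let ?h = "\<lambda>(E, a, H, b). em_pack E a H b"
  have "linear ?h"
    by (auto intro!: linearI simp: em_pack_add em_pack_scaleR)
  then have h: "bounded_linear ?h"
    by (simp add: linear_conv_bounded_linear)
  show ?thesis
    unfolding dpartial_def[of j "\<lambda>y. em_pack (E y) (a y) (H y) (b y)"]
    using bounded_linear.has_vector_derivative[OF h
      has_vector_derivative_Pair[OF dpartial_works[OF assms(1)]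
      has_vector_derivative_Pair[OF dpartial_works[OF assms(2)]
      has_vector_derivative_Pair[OF dpartial_works[OF assms(3)] dpartial_works[OF assms(4)]]]]]
    by (auto intro!: vector_derivative_at)
qed

lemma dpartial_minus_nth:
  fixes F :: "R3 \<Rightarrow> complex^3"
  assumes "F differentiable at x"
  shows "dpartial j (\<lambda>y. - F y $ k) x = - dpartial j F x $ k"
  unfolding dpartial_def[of j "\<lambda>y. - F y $ k"]
  by (rule vector_derivative_at)
    (intro has_vector_derivative_minus
      bounded_linear.has_vector_derivative[OF bounded_linear_vec_nth dpartial_works[OF assms]])

lemma maxwell_op_classical:
  assumes "E differentiable at x" "a differentiable at x" "H differentiable at x" "b differentiable at x"
    and "(\<lambda>y. \<epsilon> y *v E y) differentiable at x" "(\<lambda>y. \<mu> y *v H y) differentiable at x"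
  shows "op_apply (maxwell_op \<omega> \<epsilon> \<mu>) (\<lambda>y. em_pack (E y) (a y) (H y) (b y)) x = em_pack
     (ccurl E x + \<mu> x *v cgradient a x - (\<i> * \<omega>) *s (\<mu> x *v H x))
     (- cdivergence (\<lambda>y. \<epsilon> y *v E y) x)
     (ccurl H x + \<epsilon> x *v cgradient b x + (\<i> * \<omega>) *s (\<epsilon> x *v E x))
     (- cdivergence (\<lambda>y. \<mu> y *v H y) x)"
proof -
  have nth: "(\<lambda>y. - F y $ k) differentiable at x" if "F differentiable at x"
    for F :: "R3 \<Rightarrow> complex^3" and k
    using that by (auto intro!: differentiable_minus
      differentiable_compose[OF bounded_linear_imp_differentiable[OF bounded_linear_vec_nth]])
  have curl: "(\<Sum>j\<in>UNIV. ccross (axis j 1) (dpartial j F x)) = ccurl F x" for F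
    by (simp add: ccross_def ccurl_def vec_eq_iff forall_3 sum_3 axis_def)
  have grad: "(\<Sum>j\<in>UNIV. M *v (dpartial j c x *s axis j 1)) = M *v cgradient c x"
    for M :: "complex^3^3" and c
    by (simp add: vec_eq_iff cgradient_def matrix_vector_mult_def sum_3 forall_3 axis_def)
  show ?thesis
    by (simp add: op_apply_def maxwell_op_works dpartial_em_pack assms nth dpartial_minus_nth
        em_pack_sum em_pack_add sum.distrib curl grad cdivergence_def sum_negf)
      (simp add: dpartial_def)
qed

type_synonym em_jump = "(3 + 1 + 1) + (3 + 1 + 1)"
type_synonym em_bdry = "3 + 1 + 1"

definition maxwell_jump ::
    "(R3 \<Rightarrow> complex^3^3) \<Rightarrow> (R3 \<Rightarrow> complex^3^3) \<Rightarrow> R3 \<Rightarrow> R3 \<Rightarrow> complex^em^em_jump" where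
  "maxwell_jump \<epsilon> \<mu> x n = matrix (\<lambda>u.
     (ccross (cvec n) (em_E u) \<Zsemi> sc (cdot (cvec n) (\<epsilon> x *v em_E u)) \<Zsemi> sc (em_beta u)) \<Zsemi>
     (ccross (cvec n) (em_H u) \<Zsemi> sc (cdot (cvec n) (\<mu> x *v em_H u)) \<Zsemi> sc (em_alpha u)))"

definition maxwell_bdry ::
    "(R3 \<Rightarrow> complex^3^3) \<Rightarrow> R3 \<Rightarrow> R3 \<Rightarrow> complex^em^em_bdry" where
  "maxwell_bdry \<mu> x n = matrix (\<lambda>u.
     ccross (cvec n) (em_E u) \<Zsemi> sc (cdot (cvec n) (\<mu> x *v em_H u)) \<Zsemi> sc (em_beta u))"

lemma vjoin_lin:
  fixes v :: "complex^'m::finite" and w :: "complex^'n::finite"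
  shows "(v \<Zsemi> w) + (v' \<Zsemi> w') = (v + v') \<Zsemi> (w + w')" "c *s (v \<Zsemi> w) = (c *s v) \<Zsemi> (c *s w)"
  by (auto simp: vjoin_def vec_eq_iff split: sum.split)

lemma sc_lin: "sc a + sc b = sc (a + b)" "c *s sc a = sc (c * a)"
  by (simp_all add: sc_def vec_eq_iff)

lemma cdot_lin: "cdot a (b + b') = cdot a b + cdot a b'" "cdot a (c *s b) = c * cdot a b"
  by (simp_all add: cdot_def sum.distrib sum_distrib_left algebra_simps)

lemma maxwell_jump_works:
  "maxwell_jump \<epsilon> \<mu> x n *v em_pack E a H b =
     (ccross (cvec n) E \<Zsemi> sc (cdot (cvec n) (\<epsilon> x *v E)) \<Zsemi> sc b) \<Zsemi>
     (ccross (cvec n) H \<Zsemi> sc (cdot (cvec n) (\<mu> x *v H)) \<Zsemi> sc a)"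
  unfolding maxwell_jump_def
  by (subst linear_matrix_works)
    (simp_all add: vjoin_lin sc_lin em_sel_lin ccross_lin cdot_lin matrix_vector_right_distrib
      vec.scale)

lemma maxwell_bdry_works:
  "maxwell_bdry \<mu> x n *v em_pack E a H b =
     ccross (cvec n) E \<Zsemi> sc (cdot (cvec n) (\<mu> x *v H)) \<Zsemi> sc b"
  unfolding maxwell_bdry_def
  by (subst linear_matrix_works)
    (simp_all add: vjoin_lin sc_lin em_sel_lin ccross_lin cdot_lin matrix_vector_right_distrib
      vec.scale)

definition maxwell_problem ::
    "R3 set \<Rightarrow> R3 set \<Rightarrow> complex \<Rightarrow>
     (side \<Rightarrow> R3 \<Rightarrow> complex^3^3) \<Rightarrow> (side \<Rightarrow> R3 \<Rightarrow> complex^3^3) \<Rightarrow>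
     (R3 \<Rightarrow> complex^3) \<Rightarrow> (R3 \<Rightarrow> complex) \<Rightarrow> (R3 \<Rightarrow> complex) \<Rightarrow>
     (R3 \<Rightarrow> complex^3) \<Rightarrow> (R3 \<Rightarrow> complex) \<Rightarrow> (R3 \<Rightarrow> complex) \<Rightarrow>
     (R3 \<Rightarrow> complex^3) \<Rightarrow> (R3 \<Rightarrow> complex) \<Rightarrow> (R3 \<Rightarrow> complex) \<Rightarrow>
     (em, em_jump, em_bdry) transmission_problem" where
  "maxwell_problem \<Omega> \<Omega>m \<omega> \<epsilon> \<mu> E\<Gamma> D\<Gamma> \<beta>\<Gamma> H\<Gamma> B\<Gamma> \<alpha>\<Gamma> E0 B0 \<beta>0 = \<lparr>
     outer_domain = \<Omega>,
     inner_domain = \<Omega>m,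
     unknowns = {u. \<forall>s. u \<in> H1_space (region \<Omega> \<Omega>m s)},
     interior_op = (\<lambda>s. maxwell_op \<omega> (\<epsilon> s) (\<mu> s)),
     jump_op = (\<lambda>s. maxwell_jump (\<epsilon> s) (\<mu> s)),
     boundary_op = maxwell_bdry (\<mu> Outside),
     jump_data = (\<lambda>x. (E\<Gamma> x \<Zsemi> sc (D\<Gamma> x) \<Zsemi> sc (\<beta>\<Gamma> x)) \<Zsemi> (H\<Gamma> x \<Zsemi> sc (B\<Gamma> x) \<Zsemi> sc (\<alpha>\<Gamma> x))),
     boundary_data = (\<lambda>x. E0 x \<Zsemi> sc (B0 x) \<Zsemi> sc (\<beta>0 x))\<rparr>"

definition scalar_coefficient :: "complex^3^3 \<Rightarrow> bool" where
  "scalar_coefficient M \<longleftrightarrow> (\<exists>c. 0 < Re c \<and> M = mat c)"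

definition real_pos_def_coefficient :: "complex^3^3 \<Rightarrow> bool" where
  "real_pos_def_coefficient M \<longleftrightarrow>
     (\<exists>A :: real^3^3. M = map_matrix of_real A \<and> (\<forall>v. v \<noteq> 0 \<longrightarrow> 0 < v \<bullet> (A *v v)))"

text \<open>A function in \<open>W\<^sup>1\<^sup>,\<^sup>\<infinity>\<close> of a bounded Lipschitz region has a unique representative continuous
  up to the boundary. The coefficient \<open>c s\<close> is this representative, and the sign
  condition is imposed on the closed region, since the coefficients are frozen there too (for a
  function that is merely positive inside, the limiting values on the boundary may degenerate).
  Symmetry of the real matrices is not required.\<close>

definition admissible_coefficient ::
    "R3 set \<Rightarrow> R3 set \<Rightarrow> (side \<Rightarrow> R3 \<Rightarrow> complex^3^3) \<Rightarrow> bool" where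
  "admissible_coefficient \<Omega> \<Omega>m c \<longleftrightarrow>
     (\<forall>s. c s \<in> W1inf_space (region \<Omega> \<Omega>m s) \<and>
          continuous_on (closure (region \<Omega> \<Omega>m s)) (c s)) \<and>
     ((\<forall>s. \<forall>x\<in>closure (region \<Omega> \<Omega>m s). scalar_coefficient (c s x)) \<or>
      (\<forall>s. \<forall>x\<in>closure (region \<Omega> \<Omega>m s). real_pos_def_coefficient (c s x)))"

end

theory Submission
  imports Defs
begin

text \<open>Both kinds of coefficients are accretive: \<open>Re (cnj \<xi> \<bullet> M \<xi>) > 0\<close> for complex \<open>\<xi> \<noteq> 0\<close>. The frozen
  problem decouples into \<open>curl E + \<mu> \<nabla>\<alpha> = 0, div (\<epsilon> E) = 0\<close> and its counterpart for \<open>(H, \<beta>)\<close>. The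
  divergence of the first equation gives \<open>div (\<mu> \<nabla>\<alpha>) = 0\<close>, and continuity of \<open>E\<^sub>\<tau>\<close> makes the flux
  \<open>n \<bullet> \<mu> \<nabla>\<alpha> = - n \<bullet> curl E\<close> continuous, so an energy identity along the normal yields \<open>\<alpha> = 0\<close>. Then
  \<open>E\<close> is a gradient, and a second energy identity, now with \<open>\<epsilon>\<close>, yields \<open>E = 0\<close>.\<close>

section \<open>Vector algebra in complex three-space\<close>

lemma cvec_simps [simp]: "cvec (- n) = - cvec n" "cvec n $ i = of_real (n $ i)"
  by (simp_all add: cvec_def vec_eq_iff)

lemma cdot_simps [simp]:
  "cdot 0 b = 0" "cdot a 0 = 0"
  "cdot (- a) b = - cdot a b" "cdot a (- b) = - cdot a b"
  "cdot (a + a') b = cdot a b + cdot a' b" "cdot a (b + b') = cdot a b + cdot a b'"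
  "cdot (a - a') b = cdot a b - cdot a' b" "cdot a (b - b') = cdot a b - cdot a b'"
  "cdot (c *s a) b = c * cdot a b" "cdot a (c *s b) = c * cdot a b"
  by (simp_all add: cdot_def sum.distrib sum_distrib_left sum_negf sum_subtractf algebra_simps)

lemma ccross_simps [simp]:
  "ccross a 0 = 0" "ccross (- a) b = - ccross a b" "ccross (c *s a) b = c *s ccross a b"
  by (simp_all add: ccross_def vec_eq_iff forall_3 algebra_simps)

lemma cdot_ccross:
  "cdot a (ccross a b) = 0" "cdot b (ccross a c) = - cdot a (ccross b c)"
  by (simp_all add: cdot_def ccross_def sum_3 algebra_simps)

lemma ccross_ccross: "ccross a (ccross b c) = cdot a c *s b - cdot a b *s c"
  by (simp add: cdot_def ccross_def vec_eq_iff forall_3 sum_3 algebra_simps)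

lemma cdot_cvec: "cdot (cvec a) (cvec b) = of_real (a \<bullet> b)"
  by (simp add: cdot_def inner_vec_def)

lemma cdot_cvec_self_neq_0: "\<sigma> \<noteq> 0 \<Longrightarrow> cdot (cvec \<sigma>) (cvec \<sigma>) \<noteq> 0"
  by (simp add: cdot_cvec)

text \<open>Since n \<times> (n \<times> e) = (n \<bullet> e) n - (n \<bullet> n) e, pairing with a
  tangential \<sigma> leaves only the multiple - (n \<bullet> n) of \<sigma> \<bullet> e.\<close>

lemma cdot_tangential_eq_0:
  assumes "n \<noteq> 0" "\<sigma> \<bullet> n = 0" "ccross (cvec n) e = 0"
  shows "cdot (cvec \<sigma>) e = 0"
proof -
  have "cdot (cvec \<sigma>) (ccross (cvec n) (ccross (cvec n) e)) = 0"
    by (simp add: assms)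
  then have "cdot (cvec n) (cvec n) * cdot (cvec \<sigma>) e = 0"
    using assms(2) by (simp add: ccross_ccross cdot_cvec inner_commute)
  with cdot_cvec_self_neq_0[OF assms(1)] show ?thesis by simp
qed

lemma bounded_linear_cdot: "bounded_linear (cdot a)"
  unfolding linear_conv_bounded_linear[symmetric]
  by (rule linearI) (simp_all add: cdot_def sum.distrib scaleR_sum_right algebra_simps)

lemma bounded_linear_ccross: "bounded_linear (ccross a)"
  unfolding linear_conv_bounded_linear[symmetric]
  by (rule linearI) (simp_all add: ccross_def vec_eq_iff forall_3 algebra_simps)

lemma bounded_linear_matrix_vector_complex: "bounded_linear ((*v) (A :: complex^'n^'m))"
  unfolding linear_conv_bounded_linear[symmetric]
  by (rule linearI)
    (simp_all add: matrix_vector_mult_def vec_eq_iff sum.distrib scaleR_sum_right algebra_simps)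

section \<open>Accretive coefficient matrices\<close>

definition accretive :: "complex^3^3 \<Rightarrow> bool" where
  "accretive M \<longleftrightarrow> (\<forall>\<xi>. \<xi> \<noteq> 0 \<longrightarrow> 0 < Re (cdot (\<chi> i. cnj (\<xi> $ i)) (M *v \<xi>)))"

lemma accretive_ge_0: "accretive M \<Longrightarrow> 0 \<le> Re (cdot (\<chi> i. cnj (\<xi> $ i)) (M *v \<xi>))"
  by (cases "\<xi> = 0") (auto simp: accretive_def less_imp_le)

lemma accretive_eq_0: "accretive M \<Longrightarrow> Re (cdot (\<chi> i. cnj (\<xi> $ i)) (M *v \<xi>)) = 0 \<Longrightarrow> \<xi> = 0"
  by (force simp: accretive_def)

text \<open>A real vector is its own conjugate, so the bilinear form agrees here with the Hermitian
  one. This is the ellipticity of div (M \<nabla>), as needed for the principal symbol.\<close>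

lemma accretive_cvec:
  assumes "accretive M" "\<sigma> \<noteq> 0"
  shows "cdot (cvec \<sigma>) (M *v cvec \<sigma>) \<noteq> 0"
proof -
  have "(\<chi> i. cnj (cvec \<sigma> $ i)) = cvec \<sigma>" "cvec \<sigma> \<noteq> 0"
    using assms(2) by (auto simp: vec_eq_iff)
  with assms(1) show ?thesis
    unfolding accretive_def by (metis less_irrefl zero_complex.sel(1))
qed

lemma accretive_scalar_coefficient:
  assumes "scalar_coefficient M"
  shows "accretive M"
  unfolding accretive_def
proof (intro allI impI)
  fix \<xi> :: "complex^3" assume "\<xi> \<noteq> 0"
  from assms obtain c where c: "0 < Re c" "M = mat c"
    by (auto simp: scalar_coefficient_def)
  have "mat c *v \<xi> = c *s \<xi>"
    by (simp add: vec_eq_iff mat_def matrix_vector_mult_def if_distrib if_distribR cong: if_cong)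
  then have "cdot (\<chi> i. cnj (\<xi> $ i)) (M *v \<xi>) = c * (\<Sum>i\<in>UNIV. cnj (\<xi> $ i) * \<xi> $ i)"
    by (simp add: c) (simp add: cdot_def)
  also have "(\<Sum>i\<in>UNIV. cnj (\<xi> $ i) * \<xi> $ i) = of_real (\<Sum>i\<in>UNIV. (cmod (\<xi> $ i))\<^sup>2)"
    unfolding of_real_sum by (rule sum.cong) (simp_all add: complex_norm_square mult.commute del: of_real_power)
  finally have "Re (cdot (\<chi> i. cnj (\<xi> $ i)) (M *v \<xi>)) = Re c * (\<Sum>i\<in>UNIV. (cmod (\<xi> $ i))\<^sup>2)"
    by simp
  moreover have "(\<Sum>i\<in>UNIV. (cmod (\<xi> $ i))\<^sup>2) > 0"
    using \<open>\<xi> \<noteq> 0\<close> by (auto simp: vec_eq_iff intro!: sum_pos2)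
  ultimately show "0 < Re (cdot (\<chi> i. cnj (\<xi> $ i)) (M *v \<xi>))"
    using c by simp
qed

text \<open>Write \<xi> = a + i b with a, b real. As A is real, the mixed terms a \<bullet> A b - b
  \<bullet> A a enter only the imaginary part, also for nonsymmetric A.\<close>

lemma accretive_real_pos_def_coefficient:
  assumes "real_pos_def_coefficient M"
  shows "accretive M"
  unfolding accretive_def
proof (intro allI impI)
  fix \<xi> :: "complex^3" assume "\<xi> \<noteq> 0"
  from assms obtain A :: "real^3^3" where A: "M = map_matrix of_real A" "\<And>v. v \<noteq> 0 \<Longrightarrow> 0 < v \<bullet> (A *v v)"
    by (auto simp: real_pos_def_coefficient_def)
  define a b :: "real^3" where "a = (\<chi> i. Re (\<xi> $ i))" and "b = (\<chi> i. Im (\<xi> $ i))"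
  have "a \<noteq> 0 \<or> b \<noteq> 0"
    using \<open>\<xi> \<noteq> 0\<close> by (auto simp: a_def b_def vec_eq_iff complex_eq_iff)
  moreover have "0 \<le> v \<bullet> (A *v v)" for v
    using A(2)[of v] by (cases "v = 0") auto
  moreover have "Re (cdot (\<chi> i. cnj (\<xi> $ i)) (M *v \<xi>)) = a \<bullet> (A *v a) + b \<bullet> (A *v b)"
    by (simp add: A(1) a_def b_def cdot_def map_matrix_def matrix_vector_mult_def inner_vec_def
        sum_3 algebra_simps)
  ultimately show "0 < Re (cdot (\<chi> i. cnj (\<xi> $ i)) (M *v \<xi>))"
    using A(2)[of a] A(2)[of b] by (metis add_nonneg_pos add_pos_nonneg)
qed

lemma admissible_coefficient_accretive:
  assumes "admissible_coefficient \<Omega> \<Omega>m c" "x \<in> closure (region \<Omega> \<Omega>m s)"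
  shows "accretive (c s x)"
  using assms accretive_scalar_coefficient accretive_real_pos_def_coefficient
  unfolding admissible_coefficient_def by blast

section \<open>Energy argument on the half-line\<close>

text \<open>f is nondecreasing and starts from the limit 0 at minus infinity, hence is nonnegative.
  If also f 0 = 0, then f is squeezed between 0 and f 0, so it is constant and its derivative
  vanishes.\<close>

lemma halfline_energy:
  fixes f d :: "real \<Rightarrow> real"
  assumes cont: "continuous_on {..0} f" and lim: "(f \<longlongrightarrow> 0) at_bot"
    and der: "\<And>t. t < 0 \<Longrightarrow> (f has_real_derivative d t) (at t)"
    and nonneg: "\<And>t. t < 0 \<Longrightarrow> 0 \<le> d t"
  shows "0 \<le> f 0" and "f 0 = 0 \<Longrightarrow> t < 0 \<Longrightarrow> d t = 0"
proof -
  have mono: "f r \<le> f s" if "r \<le> s" "s \<le> 0" for r s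
  proof (cases "r = s")
    case False
    show ?thesis
    proof (rule DERIV_nonneg_imp_increasing_open[OF that(1)])
      show "\<exists>y. (f has_real_derivative y) (at x) \<and> 0 \<le> y" if "r < x" "x < s" for x
        using der[of x] nonneg[of x] that \<open>s \<le> 0\<close> by auto
      show "continuous_on {r..s} f"
        using that by (intro continuous_on_subset[OF cont]) auto
    qed
  qed simp
  have ge_0: "0 \<le> f s" if "s \<le> 0" for s
    using lim
  proof (rule tendsto_upperbound)
    show "\<forall>\<^sub>F r in at_bot. f r \<le> f s"
      using eventually_le_at_bot[of s] by eventually_elim (rule mono[OF _ that])
  qed simp
  show "0 \<le> f 0" by (rule ge_0) simp
  show "d t = 0" if "f 0 = 0" "t < 0"
  proof -
    have zero: "f s = 0" if "s \<le> 0" for s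
      using ge_0[OF that] mono[of s 0] that \<open>f 0 = 0\<close> by simp
    have "((\<lambda>_. 0) has_real_derivative d t) (at t)"
      by (rule has_field_derivative_transform_within_open[OF der[OF that(2)], of "{..<0}"])
        (use that zero in auto)
    then show ?thesis by (rule DERIV_unique) (rule DERIV_const)
  qed
qed

text \<open>Exponential decay is replaced by a zero limit, which suffices for the energy argument.
  The derivative is an explicit argument, so a bounded linear map can be applied to the profile and
  its derivative together.\<close>

definition decaying_halfline :: "(real \<Rightarrow> 'a::real_normed_vector) \<Rightarrow> (real \<Rightarrow> 'a) \<Rightarrow> bool" where
  "decaying_halfline v v' \<longleftrightarrow> continuous_on {..0} v \<and> (v \<longlongrightarrow> 0) at_bot \<and>
     (\<forall>t<0. (v has_vector_derivative v' t) (at t))"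

lemma decaying_halfline_linear:
  assumes "bounded_linear L" "decaying_halfline v v'"
  shows "decaying_halfline (\<lambda>t. L (v t)) (\<lambda>t. L (v' t))"
  using assms(2) unfolding decaying_halfline_def
  using bounded_linear.continuous_on[OF assms(1)] bounded_linear.tendsto_zero[OF assms(1)]
    bounded_linear.has_vector_derivative[OF assms(1)] by blast

text \<open>The energy is the product of a conjugated potential f and its normal flux q; the sign
  condition is on the derivative given by the product rule. It is applied to a with - n \<bullet>
  curl e, and to a potential of e with n \<bullet> N e.\<close>

lemma halfline_energy_product:
  assumes f: "decaying_halfline f f'" and q: "decaying_halfline q q'"
    and nonneg: "\<And>t. t < 0 \<Longrightarrow> 0 \<le> Re (cnj (f' t) * q t + cnj (f t) * q' t)"
  shows "0 \<le> Re (cnj (f 0) * q 0)"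
    and "Re (cnj (f 0) * q 0) = 0 \<Longrightarrow> t < 0 \<Longrightarrow> Re (cnj (f' t) * q t + cnj (f t) * q' t) = 0"
proof -
  let ?g = "\<lambda>t. Re (cnj (f t) * q t)"
  have cont: "continuous_on {..0} ?g"
    using f q by (auto simp: decaying_halfline_def intro!: continuous_intros)
  have "((\<lambda>t. Re (cnj (f t) * q t)) \<longlongrightarrow> Re (cnj 0 * 0)) at_bot"
    using f q unfolding decaying_halfline_def by (intro tendsto_intros) auto
  then have lim: "(?g \<longlongrightarrow> 0) at_bot" by simp
  have der: "(?g has_real_derivative Re (cnj (f' t) * q t + cnj (f t) * q' t)) (at t)" if "t < 0" for t
  proof -
    have "((\<lambda>t. cnj (f t) * q t) has_vector_derivative cnj (f t) * q' t + cnj (f' t) * q t) (at t)"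
      using f q that unfolding decaying_halfline_def
      by (intro has_vector_derivative_mult
          bounded_linear.has_vector_derivative[OF bounded_linear_cnj]) auto
    from bounded_linear.has_vector_derivative[OF bounded_linear_Re this] show ?thesis
      by (simp add: has_real_derivative_iff_has_vector_derivative add.commute)
  qed
  show "0 \<le> Re (cnj (f 0) * q 0)"
    by (rule halfline_energy(1)[OF cont lim der nonneg])
  show "Re (cnj (f 0) * q 0) = 0 \<Longrightarrow> t < 0 \<Longrightarrow> Re (cnj (f' t) * q t + cnj (f t) * q' t) = 0"
    by (rule halfline_energy(2)[OF cont lim der nonneg])
qed

text \<open>The differential equations, and hence the energy argument, reach only t < 0; continuity
  adds the endpoint.\<close>

lemma decaying_halfline_eq_0:
  assumes "decaying_halfline v v'" "\<And>t. t < 0 \<Longrightarrow> v t = 0" "t \<le> 0"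
  shows "v t = 0"
proof (rule continuous_constant_on_closure[of "{..<0}" v])
  show "continuous_on (closure {..<0}) v"
    using assms(1) by (simp add: decaying_halfline_def)
qed (use assms in auto)

section \<open>Uniqueness of decaying modes for the decoupled systems\<close>

text \<open>The profiles of plane waves solving \<open>curl e + M \<nabla>a = 0\<close>, \<open>div (N e) = 0\<close> in the half-space
  \<open>n \<bullet> x < 0\<close>; the Maxwell system splits into the two such systems for \<open>(E, \<alpha>)\<close> and \<open>(H, \<beta>)\<close>.\<close>

definition curl_div_mode :: "complex^3^3 \<Rightarrow> complex^3^3 \<Rightarrow> R3 \<Rightarrow> R3 \<Rightarrow>
    (real \<Rightarrow> complex^3) \<Rightarrow> (real \<Rightarrow> complex^3) \<Rightarrow> (real \<Rightarrow> complex) \<Rightarrow> (real \<Rightarrow> complex) \<Rightarrow> bool" where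
  "curl_div_mode M N \<sigma> n e e' a a' \<longleftrightarrow> decaying_halfline e e' \<and> decaying_halfline a a' \<and>
     (\<forall>t<0. ccross (\<i> *s cvec \<sigma>) (e t) + ccross (cvec n) (e' t) +
        M *v (a t *s (\<i> *s cvec \<sigma>) + a' t *s cvec n) = 0 \<and>
        cdot (\<i> *s cvec \<sigma>) (N *v e t) + cdot (cvec n) (N *v e' t) = 0)"

text \<open>The flux \<open>n \<bullet> M \<nabla>a = - n \<bullet> curl e\<close> contains only tangential derivatives of \<open>e\<close>, so it can be
  differentiated once more although \<open>a\<close> is not known to be twice differentiable.\<close>

lemma curl_div_mode_potential:
  assumes M: "accretive M" and \<sigma>: "\<sigma> \<noteq> 0" "\<sigma> \<bullet> n = 0" and mode: "curl_div_mode M N \<sigma> n e e' a a'"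
  shows "0 \<le> Re (cnj (a 0) * - cdot (cvec n) (ccross (\<i> *s cvec \<sigma>) (e 0)))"
    and "Re (cnj (a 0) * - cdot (cvec n) (ccross (\<i> *s cvec \<sigma>) (e 0))) = 0 \<Longrightarrow> t \<le> 0 \<Longrightarrow> a t = 0"
proof -
  \<comment> \<open>On modes the gradient acts as \<zeta> + \<nu> d/dt. So \<open>D\<close> is the
    profile of \<nabla>a, and \<open>q (e t)\<close> that of - n \<bullet> curl e, the \<nu>
    \<times> e' part being orthogonal to \<nu>.\<close>
  define \<zeta> \<nu> where "\<zeta> = \<i> *s cvec \<sigma>" and "\<nu> = cvec n"
  define D where "D t = a t *s \<zeta> + a' t *s \<nu>" for t
  define q where "q v = - cdot \<nu> (ccross \<zeta> v)" for v
  have a: "decaying_halfline a a'" and e: "decaying_halfline e e'"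
    and eq: "\<And>t. t < 0 \<Longrightarrow> ccross \<zeta> (e t) + ccross \<nu> (e' t) + M *v D t = 0"
    using mode by (auto simp: curl_div_mode_def \<zeta>_def \<nu>_def D_def)
  have "bounded_linear q"
    unfolding q_def
    by (intro bounded_linear_minus bounded_linear_compose[OF bounded_linear_cdot] bounded_linear_ccross)
  then have q: "decaying_halfline (\<lambda>t. q (e t)) (\<lambda>t. q (e' t))"
    using e by (rule decaying_halfline_linear)
  have energy: "cnj (a' t) * q (e t) + cnj (a t) * q (e' t) = cdot (\<chi> i. cnj (D t $ i)) (M *v D t)"
    if "t < 0" for t
  proof -
    have MD: "M *v D t = - ccross \<zeta> (e t) - ccross \<nu> (e' t)"
      using eq[OF that] by (simp add: algebra_simps add_eq_0_iff2)
    have "cdot \<nu> (M *v D t) = q (e t)"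
      by (simp add: MD cdot_ccross(1) q_def)
    \<comment> \<open>Together with the previous identity this expresses div (M \<nabla>a) =
      0.\<close>
    moreover have "cdot \<zeta> (M *v D t) = - q (e' t)"
      by (simp add: MD cdot_ccross(1) q_def cdot_ccross(2)[of \<nu> \<zeta>])
    \<comment> \<open>\<zeta> is purely imaginary and \<nu> real, so conjugation flips the sign of
      the \<zeta> term only.\<close>
    moreover have "(\<chi> i. cnj (D t $ i)) = (- cnj (a t)) *s \<zeta> + cnj (a' t) *s \<nu>"
      by (simp add: D_def \<zeta>_def \<nu>_def vec_eq_iff)
    ultimately show ?thesis by simp
  qed
  have nonneg: "0 \<le> Re (cnj (a' t) * q (e t) + cnj (a t) * q (e' t))" if "t < 0" for t
    using energy[OF that] accretive_ge_0[OF M, of "D t"] by simp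
  show "0 \<le> Re (cnj (a 0) * - cdot (cvec n) (ccross (\<i> *s cvec \<sigma>) (e 0)))"
    using halfline_energy_product(1)[OF a q nonneg] by (simp add: q_def \<zeta>_def \<nu>_def)
  assume "Re (cnj (a 0) * - cdot (cvec n) (ccross (\<i> *s cvec \<sigma>) (e 0))) = 0"
  then have zero: "Re (cnj (a 0) * q (e 0)) = 0"
    by (simp add: q_def \<zeta>_def \<nu>_def)
  have "a s = 0" if "s < 0" for s
  proof -
    have "D s = 0"
      using halfline_energy_product(2)[OF a q nonneg zero that] energy[OF that]
      by (intro accretive_eq_0[OF M]) simp
    \<comment> \<open>Pairing with \<sigma> removes the normal part of \<open>D s\<close> and
      isolates \<open>a s\<close>.\<close>
    then have "cdot (cvec \<sigma>) (D s) = 0" by simp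
    then show ?thesis
      using \<sigma> by (simp add: D_def \<zeta>_def \<nu>_def cdot_cvec)
  qed
  then show "t \<le> 0 \<Longrightarrow> a t = 0"
    using decaying_halfline_eq_0[OF a] by blast
qed

text \<open>With a = 0 the field is curl free, and its potential can be read off from e: it is -
  \<zeta> \<bullet> e, with \<zeta> = i \<sigma>, divided by \<sigma> \<bullet> \<sigma>. By div (N
  e) = 0, the product of the conjugate of - \<zeta> \<bullet> e with the flux n \<bullet> N e has as
  derivative \<sigma> \<bullet> \<sigma> times the Hermitian form of N at e.\<close>

lemma curl_div_mode_field:
  assumes N: "accretive N" and \<sigma>: "\<sigma> \<noteq> 0" "\<sigma> \<bullet> n = 0" and mode: "curl_div_mode M N \<sigma> n e e' a a'"
    and a: "\<And>t. t < 0 \<Longrightarrow> a t = 0"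
  shows "0 \<le> Re (cnj (- cdot (\<i> *s cvec \<sigma>) (e 0)) * cdot (cvec n) (N *v e 0))"
    and "Re (cnj (- cdot (\<i> *s cvec \<sigma>) (e 0)) * cdot (cvec n) (N *v e 0)) = 0 \<Longrightarrow> t \<le> 0 \<Longrightarrow> e t = 0"
proof -
  define \<zeta> \<nu> where "\<zeta> = \<i> *s cvec \<sigma>" and "\<nu> = cvec n"
  define p where "p v = - cdot \<zeta> v" for v
  have e: "decaying_halfline e e'"
    using mode by (auto simp: curl_div_mode_def)
  have p: "decaying_halfline (\<lambda>t. p (e t)) (\<lambda>t. p (e' t))"
    unfolding p_def
    by (intro decaying_halfline_linear[OF _ e] bounded_linear_minus bounded_linear_cdot)
  have q: "decaying_halfline (\<lambda>t. cdot \<nu> (N *v e t)) (\<lambda>t. cdot \<nu> (N *v e' t))"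
    by (intro decaying_halfline_linear[OF _ e] bounded_linear_compose[OF bounded_linear_cdot]
        bounded_linear_matrix_vector_complex)
  have a': "a' t = 0" if "t < 0" for t
  proof -
    have "(a has_vector_derivative a' t) (at t)"
      using mode that by (simp add: curl_div_mode_def decaying_halfline_def)
    then have "((\<lambda>_. 0) has_vector_derivative a' t) (at t)"
      by (rule has_vector_derivative_transform_within_open[of _ _ _ "{..<0}"]) (use that a in auto)
    then show ?thesis
      using vector_derivative_at by fastforce
  qed
  have energy: "cnj (p (e' t)) * cdot \<nu> (N *v e t) + cnj (p (e t)) * cdot \<nu> (N *v e' t) =
      of_real (\<sigma> \<bullet> \<sigma>) * cdot (\<chi> i. cnj (e t $ i)) (N *v e t)" if "t < 0" for t
  proof -
    have curl: "ccross \<zeta> (e t) + ccross \<nu> (e' t) = 0"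
      and div: "cdot \<zeta> (N *v e t) + cdot \<nu> (N *v e' t) = 0"
      using mode that a[OF that] a'[OF that] by (auto simp: curl_div_mode_def \<zeta>_def \<nu>_def)
    have sym: "cdot \<zeta> \<zeta> = - of_real (\<sigma> \<bullet> \<sigma>)" "cdot \<zeta> \<nu> = 0"
      using \<sigma> by (simp_all add: \<zeta>_def \<nu>_def cdot_cvec)
    \<comment> \<open>Crossing curl e = 0 once more with \<zeta> and expanding the double products
      exhibits (\<sigma> \<bullet> \<sigma>) e as the gradient of p.\<close>
    have "ccross \<zeta> (ccross \<zeta> (e t)) + ccross \<zeta> (ccross \<nu> (e' t)) = 0"
      using arg_cong[OF curl, of "ccross \<zeta>"] by (simp add: ccross_lin)
    then have "of_real (\<sigma> \<bullet> \<sigma>) *s e t = p (e t) *s \<zeta> + p (e' t) *s \<nu>"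
      unfolding ccross_ccross sym by (simp add: p_def vec_eq_iff algebra_simps add_eq_0_iff2)
    then have "(\<chi> i. cnj ((of_real (\<sigma> \<bullet> \<sigma>) *s e t) $ i)) = (\<chi> i. cnj ((p (e t) *s \<zeta> + p (e' t) *s \<nu>) $ i))"
      by simp
    then have "of_real (\<sigma> \<bullet> \<sigma>) *s (\<chi> i. cnj (e t $ i)) = (- cnj (p (e t))) *s \<zeta> + cnj (p (e' t)) *s \<nu>"
      by (simp add: \<zeta>_def \<nu>_def vec_eq_iff)
    then have "cdot (of_real (\<sigma> \<bullet> \<sigma>) *s (\<chi> i. cnj (e t $ i))) (N *v e t) =
        cdot ((- cnj (p (e t))) *s \<zeta> + cnj (p (e' t)) *s \<nu>) (N *v e t)"
      by simp
    moreover have "cdot \<zeta> (N *v e t) = - cdot \<nu> (N *v e' t)"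
      using div by (simp add: add_eq_0_iff2)
    ultimately show ?thesis by (simp add: algebra_simps)
  qed
  have nonneg: "0 \<le> Re (cnj (p (e' t)) * cdot \<nu> (N *v e t) + cnj (p (e t)) * cdot \<nu> (N *v e' t))"
    if "t < 0" for t
    using energy[OF that] accretive_ge_0[OF N, of "e t"] by simp
  show "0 \<le> Re (cnj (- cdot (\<i> *s cvec \<sigma>) (e 0)) * cdot (cvec n) (N *v e 0))"
    using halfline_energy_product(1)[OF p q nonneg] by (simp add: p_def \<zeta>_def \<nu>_def)
  assume "Re (cnj (- cdot (\<i> *s cvec \<sigma>) (e 0)) * cdot (cvec n) (N *v e 0)) = 0"
  then have zero: "Re (cnj (p (e 0)) * cdot \<nu> (N *v e 0)) = 0"
    by (simp add: p_def \<zeta>_def \<nu>_def)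
  have "e s = 0" if "s < 0" for s
    using halfline_energy_product(2)[OF p q nonneg zero that] energy[OF that] \<sigma>(1)
    by (intro accretive_eq_0[OF N]) simp
  then show "t \<le> 0 \<Longrightarrow> e t = 0"
    using decaying_halfline_eq_0[OF e] by blast
qed

text \<open>The alternatives in \<open>bc\<close> are the conditions on (E, \<alpha>) and on (H,
  \<beta>), respectively. Each makes one factor of both boundary energies vanish: the tangential
  trace determines n \<bullet> curl e and \<sigma> \<bullet> e, while the second alternative treats
  a and n \<bullet> N e directly.\<close>

lemma curl_div_mode_boundary_eq_0:
  assumes "accretive M" "accretive N" and \<sigma>: "\<sigma> \<noteq> 0" "\<sigma> \<bullet> n = 0" and n: "n \<noteq> 0"
    and mode: "curl_div_mode M N \<sigma> n e e' a a'"
    and bc: "ccross (cvec n) (e 0) = 0 \<or> a 0 = 0 \<and> cdot (cvec n) (N *v e 0) = 0"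
    and t: "t \<le> 0"
  shows "e t = 0" and "a t = 0"
proof -
  have "cdot (cvec n) (ccross (\<i> *s cvec \<sigma>) (e 0)) = 0 \<or> a 0 = 0"
    using bc cdot_ccross(2)[of "cvec n" "cvec \<sigma>" "e 0"] by auto
  then have a: "a s = 0" if "s \<le> 0" for s
    using curl_div_mode_potential(2)[OF assms(1) \<sigma> mode _ that] by auto
  then show "a t = 0" using t by blast
  have "cdot (\<i> *s cvec \<sigma>) (e 0) = 0 \<or> cdot (cvec n) (N *v e 0) = 0"
    using bc cdot_tangential_eq_0[OF n \<sigma>(2)] by auto
  then show "e t = 0"
    using curl_div_mode_field(2)[OF assms(2) \<sigma> mode a _ t] by force
qed

text \<open>The mode on the far side of the interface is reflected, so that it lives in the same half-line
  and has the opposite normal. Both boundary energies are nonnegative while their sum vanishes.\<close>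

lemma curl_div_mode_interface_eq_0:
  assumes "accretive M" "accretive N" "accretive M'" "accretive N'"
    and \<sigma>: "\<sigma> \<noteq> 0" "\<sigma> \<bullet> n = 0" and n: "n \<noteq> 0"
    and mode: "curl_div_mode M N \<sigma> n e e' a a'" "curl_div_mode M' N' \<sigma> (- n) f f' b b'"
    and jump: "ccross (cvec n) (e 0) = ccross (cvec n) (f 0)"
      "cdot (cvec n) (N *v e 0) = cdot (cvec n) (N' *v f 0)" "a 0 = b 0"
    and t: "t \<le> 0"
  shows "e t = 0" and "a t = 0" and "f t = 0" and "b t = 0"
proof -
  have \<sigma>': "\<sigma> \<bullet> - n = 0" using \<sigma> by simp
  \<comment> \<open>Both n \<bullet> (\<sigma> \<times> e) and \<sigma> \<bullet> e depend only on
    the tangential trace of e, so they are continuous across the interface.\<close>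
  have flux: "cdot (cvec n) (ccross (\<i> *s cvec \<sigma>) (e 0)) = cdot (cvec n) (ccross (\<i> *s cvec \<sigma>) (f 0))"
    using jump(1) cdot_ccross(2)[of "cvec n" "cvec \<sigma>"] by simp
  have "ccross (cvec n) (e 0 - f 0) = 0"
    using jump(1) by (simp add: bounded_linear.linear[OF bounded_linear_ccross, THEN linear_diff])
  from cdot_tangential_eq_0[OF n \<sigma>(2) this]
  have tang: "cdot (cvec \<sigma>) (e 0) = cdot (cvec \<sigma>) (f 0)" by simp
  note pot = curl_div_mode_potential[OF assms(1) \<sigma> mode(1)]
    curl_div_mode_potential[OF assms(3) \<sigma>(1) \<sigma>' mode(2)]
  have "Re (cnj (a 0) * - cdot (cvec n) (ccross (\<i> *s cvec \<sigma>) (e 0))) = 0"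
    "Re (cnj (b 0) * - cdot (cvec (- n)) (ccross (\<i> *s cvec \<sigma>) (f 0))) = 0"
    using pot(1) pot(3) unfolding flux jump(3) by auto
  then have a: "a s = 0" and b: "b s = 0" if "s \<le> 0" for s
    using pot(2)[OF _ that] pot(4)[OF _ that] by blast+
  then show "a t = 0" "b t = 0" using t by blast+
  note field = curl_div_mode_field[OF assms(2) \<sigma> mode(1) a[OF less_imp_le]]
    curl_div_mode_field[OF assms(4) \<sigma>(1) \<sigma>' mode(2) b[OF less_imp_le]]
  have "Re (cnj (- cdot (\<i> *s cvec \<sigma>) (e 0)) * cdot (cvec n) (N *v e 0)) = 0"
    "Re (cnj (- cdot (\<i> *s cvec \<sigma>) (f 0)) * cdot (cvec (- n)) (N' *v f 0)) = 0"
    using field(1) field(3) by (auto simp: jump(2) tang)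
  then show "e t = 0" "f t = 0"
    using field(2)[OF _ _ t] field(4)[OF _ _ t] by blast+
qed

section \<open>The principal symbol of the Maxwell operator\<close>

lemma em_pack_eta: "em_pack (em_E u) (em_alpha u) (em_H u) (em_beta u) = u"
proof -
  have "em_pack (em_E u) (em_alpha u) (em_H u) (em_beta u) $ i = u $ i" for i
    by (auto simp: em_pack_def vjoin_def sc_def em_E_def em_alpha_def em_H_def em_beta_def
        split: sum.split)
  then show ?thesis by (simp add: vec_eq_iff)
qed

lemma em_pack_eq_0_iff: "em_pack E a H b = 0 \<longleftrightarrow> E = 0 \<and> a = 0 \<and> H = 0 \<and> b = 0"
proof
  assume "em_pack E a H b = 0"
  moreover have "em_E 0 = 0" "em_alpha 0 = 0" "em_H 0 = 0" "em_beta 0 = 0"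
    by (simp_all add: em_E_def em_alpha_def em_H_def em_beta_def vec_eq_iff)
  ultimately show "E = 0 \<and> a = 0 \<and> H = 0 \<and> b = 0"
    by (metis em_pack_sel)
qed (auto simp: em_pack_def vjoin_def sc_def vec_eq_iff split: sum.split)

lemma em_eq_0_iff: "u = 0 \<longleftrightarrow> em_E u = 0 \<and> em_alpha u = 0 \<and> em_H u = 0 \<and> em_beta u = 0"
  using em_pack_eq_0_iff[of "em_E u" "em_alpha u" "em_H u" "em_beta u"] by (simp add: em_pack_eta)

text \<open>The covector w is left complex and arbitrary so that one formula serves the symbol (w =
  i \<sigma>) and, on plane waves, both the tangential part (w = i \<sigma>) and the normal part (w
  = n).\<close>

lemma maxwell_symbol:
  "(\<Sum>j\<in>UNIV. w $ j *s (cdiv (maxwell_op \<omega> \<epsilon> \<mu>) j x *v u + cgrad (maxwell_op \<omega> \<epsilon> \<mu>) j x *v u)) =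
     em_pack (ccross w (em_E u) + \<mu> x *v (em_alpha u *s w)) (- cdot w (\<epsilon> x *v em_E u))
       (ccross w (em_H u) + \<epsilon> x *v (em_beta u *s w)) (- cdot w (\<mu> x *v em_H u))"
proof -
  have w: "(\<Sum>j\<in>UNIV. w $ j *s (ccross (axis j 1) F + M *v (c *s axis j 1))) = ccross w F + M *v (c *s w)"
    for F M c
    by (simp add: ccross_def vec_eq_iff forall_3 sum_3 axis_def matrix_vector_mult_def algebra_simps)
  have w': "(\<Sum>j\<in>UNIV. w $ j * - (F $ j)) = - cdot w F" for F
    by (simp add: cdot_def sum_negf)
  show ?thesis
    unfolding maxwell_op_works em_pack_add em_pack_scale em_pack_sum by (simp only: w w' add_0 add_0_right)
qed

text \<open>A square matrix with trivial kernel is invertible, and the kernel equations split into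
  two systems with \<epsilon> and \<mu> exchanged. Pairing the curl equation with \<sigma> gives c
  (\<sigma> \<bullet> M \<sigma>) = 0, hence c = 0. Then F is parallel to \<sigma>, and \<sigma>
  \<bullet> N F = 0 forces F = 0.\<close>

lemma maxwell_elliptic_symbol:
  assumes \<epsilon>: "accretive (\<epsilon> x)" and \<mu>: "accretive (\<mu> x)" and \<sigma>: "\<sigma> \<noteq> 0"
  shows "invertible (principal_symbol (maxwell_op \<omega> \<epsilon> \<mu>) x \<sigma>)"
proof -
  have zero: "F = 0 \<and> c = 0"
    if eq: "ccross (\<i> *s cvec \<sigma>) F + M *v (c *s (\<i> *s cvec \<sigma>)) = 0" "cdot (\<i> *s cvec \<sigma>) (N *v F) = 0"
      and M: "accretive M" and N: "accretive N" for F c M N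
  proof -
    have "cdot (cvec \<sigma>) (ccross (\<i> *s cvec \<sigma>) F + M *v (c *s (\<i> *s cvec \<sigma>))) = 0"
      unfolding eq(1) by simp
    then have c: "c = 0"
      using accretive_cvec[OF M \<sigma>] by (simp add: cdot_ccross vec.scale)
    then have "ccross (cvec \<sigma>) F = 0"
      using eq(1) by simp
    then have "ccross (cvec \<sigma>) (ccross (cvec \<sigma>) F) = 0"
      by simp
    then have F: "cdot (cvec \<sigma>) (cvec \<sigma>) *s F = cdot (cvec \<sigma>) F *s cvec \<sigma>"
      by (simp add: ccross_ccross)
    have "cdot (cvec \<sigma>) (N *v (cdot (cvec \<sigma>) (cvec \<sigma>) *s F)) = 0"
      using eq(2) by (simp add: vec.scale)
    then have "cdot (cvec \<sigma>) F = 0"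
      unfolding F using accretive_cvec[OF N \<sigma>] by (simp add: vec.scale)
    with F c cdot_cvec_self_neq_0[OF \<sigma>] show ?thesis by simp
  qed
  have "u = 0" if "principal_symbol (maxwell_op \<omega> \<epsilon> \<mu>) x \<sigma> *v u = 0" for u
  proof -
    have eq: "principal_symbol (maxwell_op \<omega> \<epsilon> \<mu>) x \<sigma> *v u =
      (\<Sum>j\<in>UNIV. (\<i> *s cvec \<sigma>) $ j *s (cdiv (maxwell_op \<omega> \<epsilon> \<mu>) j x *v u + cgrad (maxwell_op \<omega> \<epsilon> \<mu>) j x *v u))"
      by (simp add: principal_symbol_def matrix_vector_mult_def vec_eq_iff sum_distrib_left
          sum_distrib_right sum.distrib algebra_simps) (intro allI arg_cong2[where f = "(+)"]; rule sum.swap)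
    show ?thesis
      using that[unfolded eq maxwell_symbol em_pack_eq_0_iff neg_equal_0_iff_equal]
        zero[OF _ _ \<mu> \<epsilon>] zero[OF _ _ \<epsilon> \<mu>]
      unfolding em_eq_0_iff[of u] by blast
  qed
  then show ?thesis
    by (simp add: invertible_left_inverse matrix_left_invertible_ker)
qed

text \<open>\<open>L\<close> covers both kinds of leading terms: multiplication by a frozen
  \<open>cdiv\<close> matrix inside the derivative, and the identity for
  \<open>cgrad\<close>.\<close>

lemma dpartial_linear_normal_mode:
  assumes L: "bounded_linear L" and v: "(v has_vector_derivative v') (at (n \<bullet> x))"
  shows "dpartial j (\<lambda>y. L (normal_mode \<sigma> n v y)) x =
    L (exp (\<i> * of_real (\<sigma> \<bullet> x)) *s ((\<i> *s cvec \<sigma>) $ j *s v (n \<bullet> x) + cvec n $ j *s v'))"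
proof -
  let ?x = "\<lambda>t. x + t *\<^sub>R axis j 1"
  have line: "((\<lambda>t. w \<bullet> ?x t) has_vector_derivative w $ j) (at 0)" for w :: R3
    by (auto intro!: derivative_eq_intros simp: has_vector_derivative_def inner_axis algebra_simps)
  have "((v \<circ> (\<lambda>t. n \<bullet> ?x t)) has_vector_derivative n $ j *\<^sub>R v') (at 0)"
    by (rule vector_diff_chain_at[OF line]) (use v in simp)
  then have v: "((\<lambda>t. v (n \<bullet> ?x t)) has_vector_derivative cvec n $ j *s v') (at 0)"
    by (simp add: o_def scaleR_conv_of_real vec_eq_iff vector_scalar_mult_def scaleR_vec_def)
  have "((exp \<circ> (\<lambda>t. \<i> * of_real (\<sigma> \<bullet> ?x t))) has_vector_derivative
      (\<i> * of_real (\<sigma> $ j)) * exp (\<i> * of_real (\<sigma> \<bullet> ?x 0))) (at 0)"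
    by (rule field_vector_diff_chain_at)
      (auto intro!: has_vector_derivative_mult_right bounded_linear.has_vector_derivative[OF bounded_linear_of_real] line
        DERIV_exp)
  then have exp: "((\<lambda>t. exp (\<i> * of_real (\<sigma> \<bullet> ?x t))) has_vector_derivative
      exp (\<i> * of_real (\<sigma> \<bullet> x)) * (\<i> *s cvec \<sigma>) $ j) (at 0)"
    by (simp add: o_def algebra_simps)
  have "bilinear ((*s) :: complex \<Rightarrow> complex^'a \<Rightarrow> complex^'a)"
    by (auto simp: bilinear_def vec_eq_iff algebra_simps intro!: linearI)
  then have bil: "bounded_bilinear ((*s) :: complex \<Rightarrow> complex^'a \<Rightarrow> complex^'a)"
    by (simp add: bilinear_conv_bounded_bilinear)
  have "((\<lambda>t. normal_mode \<sigma> n v (?x t)) has_vector_derivative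
     exp (\<i> * of_real (\<sigma> \<bullet> x)) *s ((\<i> *s cvec \<sigma>) $ j *s v (n \<bullet> x) + cvec n $ j *s v')) (at 0)"
    using bounded_bilinear.has_vector_derivative[OF bil exp v]
    by (simp add: normal_mode_def vec.scale_right_distrib add.commute mult.assoc)
  from bounded_linear.has_vector_derivative[OF L this] show ?thesis
    unfolding dpartial_def by (rule vector_derivative_at)
qed

text \<open>Constant coefficients commute with differentiation, so \<open>cdiv\<close> and
  \<open>cgrad\<close> contribute alike and the exponential factors out. What remains is a
  first-order differential expression in the normal variable.\<close>

lemma frozen_op_normal_mode:
  assumes v: "(v has_vector_derivative v') (at (n \<bullet> x))"
  shows "op_apply (frozen_principal L x0) (normal_mode \<sigma> n v) x = exp (\<i> * of_real (\<sigma> \<bullet> x)) *s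
    ((\<Sum>j\<in>UNIV. (\<i> *s cvec \<sigma>) $ j *s (cdiv L j x0 *v v (n \<bullet> x) + cgrad L j x0 *v v (n \<bullet> x))) +
     (\<Sum>j\<in>UNIV. cvec n $ j *s (cdiv L j x0 *v v' + cgrad L j x0 *v v')))"
proof -
  note d = dpartial_linear_normal_mode[OF bounded_linear_matrix_vector_complex v]
    dpartial_linear_normal_mode[OF bounded_linear_ident v]
  show ?thesis
    by (simp add: op_apply_def frozen_principal_def d vec.scale matrix_vector_right_distrib
        vec.scale_right_distrib vec.scale_sum_right sum.distrib del: cvec_simps)
qed

lemma decaying_profile_reflect:
  assumes "decaying_profile {0..} v"
  shows "decaying_profile {..0} (\<lambda>t. v (- t))"
proof -
  obtain C \<delta> where *: "0 < \<delta>" "\<And>t. 0 \<le> t \<Longrightarrow> norm (v t) \<le> C * exp (- \<delta> * \<bar>t\<bar>)"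
    using assms by (auto simp: decaying_profile_def)
  have "continuous_on {0..} v"
    using assms by (simp add: decaying_profile_def)
  then have "continuous_on {..0} (\<lambda>t. v (- t))"
    by (rule continuous_on_compose2) (auto intro: continuous_on_minus continuous_on_id)
  moreover have "(\<lambda>t. v (- t)) differentiable_on {..<0}"
  proof (rule differentiable_on_compose[of uminus _ v])
    have "uminus ` {..<0::real} = {0<..}"
      by simp
    then show "v differentiable_on uminus ` {..<0}"
      using assms by (simp add: decaying_profile_def)
    show "uminus differentiable_on {..<0::real}"
      by (simp add: linear_imp_differentiable_on linear_uminus)
  qed
  moreover have "\<forall>t\<in>{..0}. norm (v (- t)) \<le> C * exp (- \<delta> * \<bar>t\<bar>)"
    using *(2)[of "- _"] by auto
  ultimately show ?thesis
    using *(1) by (auto simp: decaying_profile_def)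
qed

lemma decaying_profile_halfline:
  assumes "decaying_profile {..0} v"
  shows "decaying_halfline v (\<lambda>t. vector_derivative v (at t))"
proof -
  obtain C \<delta> where *: "0 < \<delta>" "\<And>t. t \<le> 0 \<Longrightarrow> norm (v t) \<le> C * exp (- \<delta> * \<bar>t\<bar>)"
    using assms by (auto simp: decaying_profile_def)
  have "LIM t at_bot. \<delta> * t :> at_bot"
    using *(1) by (simp add: filterlim_tendsto_pos_mult_at_bot[OF tendsto_const] filterlim_ident)
  then have "((\<lambda>t. C * exp (\<delta> * t)) \<longlongrightarrow> C * 0) at_bot"
    by (intro tendsto_mult_left filterlim_compose[OF exp_at_bot])
  then have "(v \<longlongrightarrow> 0) at_bot"
    by (intro Lim_null_comparison[of v "\<lambda>t. C * exp (\<delta> * t)"])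
      (use *(2) in \<open>auto intro!: eventually_mono[OF eventually_le_at_bot[of 0]]\<close>)
  moreover have "v differentiable (at t)" if "t < 0" for t
  proof -
    have "v differentiable_on {..<0}"
      using assms by (simp add: decaying_profile_def)
    then show ?thesis
      using that by (simp add: differentiable_on_eq_differentiable_at)
  qed
  ultimately show ?thesis
    using assms by (simp add: decaying_halfline_def decaying_profile_def vector_derivative_works)
qed

text \<open>The exponential never vanishes and can be cancelled. The four blocks then separate into
  the system for (E, \<alpha>) and the one for (H, \<beta>), where \<epsilon> and \<mu> have
  exchanged roles.\<close>

lemma maxwell_normal_mode:
  assumes v: "decaying_profile {..0} v" and n: "n \<noteq> 0"
    and op: "\<And>x. n \<bullet> x < 0 \<Longrightarrow> op_apply (frozen_principal (maxwell_op \<omega> \<epsilon> \<mu>) x0) (normal_mode \<sigma> n v) x = 0"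
  obtains v' where
    "curl_div_mode (\<mu> x0) (\<epsilon> x0) \<sigma> n (\<lambda>t. em_E (v t)) (\<lambda>t. em_E (v' t))
      (\<lambda>t. em_alpha (v t)) (\<lambda>t. em_alpha (v' t))"
    "curl_div_mode (\<epsilon> x0) (\<mu> x0) \<sigma> n (\<lambda>t. em_H (v t)) (\<lambda>t. em_H (v' t))
      (\<lambda>t. em_beta (v t)) (\<lambda>t. em_beta (v' t))"
proof -
  define v' where "v' t = vector_derivative v (at t)" for t
  have dec: "decaying_halfline v v'"
    using decaying_profile_halfline[OF v] by (simp add: v'_def[abs_def])
  have eq: "em_pack (ccross (\<i> *s cvec \<sigma>) (em_E (v t)) + \<mu> x0 *v (em_alpha (v t) *s (\<i> *s cvec \<sigma>)))
        (- cdot (\<i> *s cvec \<sigma>) (\<epsilon> x0 *v em_E (v t)))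
        (ccross (\<i> *s cvec \<sigma>) (em_H (v t)) + \<epsilon> x0 *v (em_beta (v t) *s (\<i> *s cvec \<sigma>)))
        (- cdot (\<i> *s cvec \<sigma>) (\<mu> x0 *v em_H (v t))) +
      em_pack (ccross (cvec n) (em_E (v' t)) + \<mu> x0 *v (em_alpha (v' t) *s cvec n))
        (- cdot (cvec n) (\<epsilon> x0 *v em_E (v' t)))
        (ccross (cvec n) (em_H (v' t)) + \<epsilon> x0 *v (em_beta (v' t) *s cvec n))
        (- cdot (cvec n) (\<mu> x0 *v em_H (v' t))) = 0" if "t < 0" for t
  proof -
    \<comment> \<open>A point with normal coordinate t; n is only assumed nonzero, hence the
      division by n \<bullet> n.\<close>
    define x where "x = (t / (n \<bullet> n)) *\<^sub>R n"
    have x: "n \<bullet> x = t" using n by (simp add: x_def)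
    have "(v has_vector_derivative v' t) (at (n \<bullet> x))"
      using dec that by (simp add: decaying_halfline_def x)
    note frozen_op_normal_mode[OF this, of "maxwell_op \<omega> \<epsilon> \<mu>" x0 \<sigma>]
    moreover have "op_apply (frozen_principal (maxwell_op \<omega> \<epsilon> \<mu>) x0) (normal_mode \<sigma> n v) x = 0"
      using op[of x] that x by simp
    ultimately show ?thesis
      unfolding maxwell_symbol x by (metis exp_not_eq_zero vec.scale_eq_0_iff)
  qed
  have lin: "bounded_linear em_E" "bounded_linear em_H" "bounded_linear em_alpha" "bounded_linear em_beta"
    unfolding linear_conv_bounded_linear[symmetric]
    by (auto intro!: linearI simp: em_sel_lin) (simp_all add: em_E_def em_H_def em_alpha_def em_beta_def vec_eq_iff)
  note dec' = lin[THEN decaying_halfline_linear, OF dec]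
  have "ccross (\<i> *s cvec \<sigma>) (em_E (v t)) + ccross (cvec n) (em_E (v' t)) +
        \<mu> x0 *v (em_alpha (v t) *s (\<i> *s cvec \<sigma>) + em_alpha (v' t) *s cvec n) = 0"
      "ccross (\<i> *s cvec \<sigma>) (em_H (v t)) + ccross (cvec n) (em_H (v' t)) +
        \<epsilon> x0 *v (em_beta (v t) *s (\<i> *s cvec \<sigma>) + em_beta (v' t) *s cvec n) = 0"
      "cdot (\<i> *s cvec \<sigma>) (\<epsilon> x0 *v em_E (v t)) + cdot (cvec n) (\<epsilon> x0 *v em_E (v' t)) = 0"
      "cdot (\<i> *s cvec \<sigma>) (\<mu> x0 *v em_H (v t)) + cdot (cvec n) (\<mu> x0 *v em_H (v' t)) = 0"
    if "t < 0" for t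
    using eq[OF that, unfolded em_pack_add em_pack_eq_0_iff] unfolding matrix_vector_right_distrib
    by (simp_all only: add_ac minus_add_distrib[symmetric] neg_equal_0_iff_equal)
  then have "curl_div_mode (\<mu> x0) (\<epsilon> x0) \<sigma> n (\<lambda>t. em_E (v t)) (\<lambda>t. em_E (v' t))
      (\<lambda>t. em_alpha (v t)) (\<lambda>t. em_alpha (v' t))"
    "curl_div_mode (\<epsilon> x0) (\<mu> x0) \<sigma> n (\<lambda>t. em_H (v t)) (\<lambda>t. em_H (v' t))
      (\<lambda>t. em_beta (v t)) (\<lambda>t. em_beta (v' t))"
    unfolding curl_div_mode_def using dec' by blast+
  then show thesis by (rule that)
qed

section \<open>The Shapiro-Lopatinsky conditions\<close>

lemma vjoin_eq_iff:
  fixes v v' :: "'a^'m::finite" and w w' :: "'a^'n::finite"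
  shows "v \<Zsemi> w = v' \<Zsemi> w' \<longleftrightarrow> v = v' \<and> w = w'"
proof
  assume eq: "v \<Zsemi> w = v' \<Zsemi> w'"
  have "(v \<Zsemi> w) $ Inl i = (v' \<Zsemi> w') $ Inl i" "(v \<Zsemi> w) $ Inr k = (v' \<Zsemi> w') $ Inr k" for i k
    unfolding eq by simp_all
  then show "v = v' \<and> w = w'"
    by (simp add: vjoin_def vec_eq_iff)
qed simp

lemma sc_eq_iff: "sc a = sc b \<longleftrightarrow> a = b"
  by (simp add: sc_def vec_eq_iff)

lemma maxwell_jump_eq_iff:
  "maxwell_jump \<epsilon> \<mu> x n *v u = maxwell_jump \<epsilon>' \<mu>' x n *v w \<longleftrightarrow>
     ccross (cvec n) (em_E u) = ccross (cvec n) (em_E w) \<and>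
     cdot (cvec n) (\<epsilon> x *v em_E u) = cdot (cvec n) (\<epsilon>' x *v em_E w) \<and> em_beta u = em_beta w \<and>
     ccross (cvec n) (em_H u) = ccross (cvec n) (em_H w) \<and>
     cdot (cvec n) (\<mu> x *v em_H u) = cdot (cvec n) (\<mu>' x *v em_H w) \<and> em_alpha u = em_alpha w"
  using maxwell_jump_works[of \<epsilon> \<mu> x n "em_E u" "em_alpha u" "em_H u" "em_beta u"]
    maxwell_jump_works[of \<epsilon>' \<mu>' x n "em_E w" "em_alpha w" "em_H w" "em_beta w"]
  by (simp add: em_pack_eta vjoin_eq_iff sc_eq_iff)

lemma maxwell_bdry_eq_0:
  assumes "maxwell_bdry \<mu> x n *v u = 0"
  shows "ccross (cvec n) (em_E u) = 0 \<and> cdot (cvec n) (\<mu> x *v em_H u) = 0 \<and> em_beta u = 0"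
proof -
  have "(0 :: complex^em_bdry) = 0 \<Zsemi> sc 0 \<Zsemi> sc 0"
    by (auto simp: vjoin_def sc_def vec_eq_iff split: sum.split)
  with assms maxwell_bdry_works[of \<mu> x n "em_E u" "em_alpha u" "em_H u" "em_beta u"]
  have "ccross (cvec n) (em_E u) \<Zsemi> sc (cdot (cvec n) (\<mu> x *v em_H u)) \<Zsemi> sc (em_beta u) = 0 \<Zsemi> sc 0 \<Zsemi> sc 0"
    by (simp add: em_pack_eta)
  then show ?thesis
    by (simp only: vjoin_eq_iff sc_eq_iff simp_thms)
qed

lemma normal_mode_0: "normal_mode \<sigma> n v 0 = v 0"
  by (simp add: normal_mode_def)

text \<open>Reversing the normal and the profile together gives the same wave, so the half-space n
  \<bullet> x > 0 is treated as (- n) \<bullet> x < 0.\<close>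

lemma normal_mode_reflect: "normal_mode \<sigma> (- n) (\<lambda>t. v (- t)) = normal_mode \<sigma> n v"
  by (simp add: normal_mode_def fun_eq_iff)

lemma maxwell_SL_boundary:
  assumes "interior_op P Outside = maxwell_op \<omega> \<epsilon> \<mu>" "boundary_op P = maxwell_bdry \<mu>"
    and acc: "accretive (\<epsilon> x0)" "accretive (\<mu> x0)" and n: "n \<noteq> 0"
  shows "SL_boundary P x0 n"
  unfolding SL_boundary_def assms(1,2)
proof (intro allI impI, elim conjE)
  fix \<sigma> :: R3 and v and t :: real
  assume \<sigma>: "\<sigma> \<noteq> 0" "\<sigma> \<bullet> n = 0" and v: "decaying_profile {..0} v" and t: "t \<le> 0"
    and op: "\<forall>x. n \<bullet> x < 0 \<longrightarrow> op_apply (frozen_principal (maxwell_op \<omega> \<epsilon> \<mu>) x0) (normal_mode \<sigma> n v) x = 0"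
    and "\<forall>x. n \<bullet> x = 0 \<longrightarrow> maxwell_bdry \<mu> x0 n *v normal_mode \<sigma> n v x = 0"
  \<comment> \<open>The origin lies on the boundary plane, and the exponential is 1 there.\<close>
  then have "maxwell_bdry \<mu> x0 n *v v 0 = 0"
    using normal_mode_0 by (metis inner_zero_right)
  note bc = maxwell_bdry_eq_0[OF this]
  obtain v' where
    v': "curl_div_mode (\<mu> x0) (\<epsilon> x0) \<sigma> n (\<lambda>t. em_E (v t)) (\<lambda>t. em_E (v' t))
      (\<lambda>t. em_alpha (v t)) (\<lambda>t. em_alpha (v' t))"
    "curl_div_mode (\<epsilon> x0) (\<mu> x0) \<sigma> n (\<lambda>t. em_H (v t)) (\<lambda>t. em_H (v' t))
      (\<lambda>t. em_beta (v t)) (\<lambda>t. em_beta (v' t))"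
    by (rule maxwell_normal_mode[OF v n]) (use op in auto)
  show "v t = 0"
    using curl_div_mode_boundary_eq_0[OF acc(2,1) \<sigma> n v'(1) _ t]
      curl_div_mode_boundary_eq_0[OF acc \<sigma> n v'(2) _ t] bc
    by (simp add: em_eq_0_iff)
qed

lemma maxwell_SL_interface:
  assumes "interior_op P = (\<lambda>s. maxwell_op \<omega> (\<epsilon> s) (\<mu> s))" "jump_op P = (\<lambda>s. maxwell_jump (\<epsilon> s) (\<mu> s))"
    and acc: "\<And>s. accretive (\<epsilon> s x0)" "\<And>s. accretive (\<mu> s x0)" and n: "n \<noteq> 0"
  shows "SL_interface P x0 n"
  unfolding SL_interface_def assms(1,2)
proof (intro allI impI, elim conjE)
  fix \<sigma> :: R3 and vp vm
  assume \<sigma>: "\<sigma> \<noteq> 0" "\<sigma> \<bullet> n = 0" and vp: "decaying_profile {0..} vp" and vm: "decaying_profile {..0} vm"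
    and op_p: "\<forall>x. n \<bullet> x > 0 \<longrightarrow>
      op_apply (frozen_principal (maxwell_op \<omega> (\<epsilon> Outside) (\<mu> Outside)) x0) (normal_mode \<sigma> n vp) x = 0"
    and op_m: "\<forall>x. n \<bullet> x < 0 \<longrightarrow>
      op_apply (frozen_principal (maxwell_op \<omega> (\<epsilon> Inside) (\<mu> Inside)) x0) (normal_mode \<sigma> n vm) x = 0"
    and jump: "\<forall>x. n \<bullet> x = 0 \<longrightarrow> maxwell_jump (\<epsilon> Outside) (\<mu> Outside) x0 n *v normal_mode \<sigma> n vp x -
      maxwell_jump (\<epsilon> Inside) (\<mu> Inside) x0 n *v normal_mode \<sigma> n vm x = 0"
  \<comment> \<open>The outer profile, moved to the half-line of the inner one.\<close>
  define w where "w t = vp (- t)" for t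
  have "maxwell_jump (\<epsilon> Inside) (\<mu> Inside) x0 n *v vm 0 = maxwell_jump (\<epsilon> Outside) (\<mu> Outside) x0 n *v w 0"
    using jump[rule_format, of 0] by (simp add: normal_mode_0 w_def)
  note j = this[unfolded maxwell_jump_eq_iff]
  have w: "decaying_profile {..0} w" "normal_mode \<sigma> (- n) w = normal_mode \<sigma> n vp"
    using decaying_profile_reflect[OF vp] normal_mode_reflect[of \<sigma> n vp] by (simp_all add: w_def[abs_def])
  obtain v' where v':
    "curl_div_mode (\<mu> Inside x0) (\<epsilon> Inside x0) \<sigma> n (\<lambda>t. em_E (vm t)) (\<lambda>t. em_E (v' t))
      (\<lambda>t. em_alpha (vm t)) (\<lambda>t. em_alpha (v' t))"
    "curl_div_mode (\<epsilon> Inside x0) (\<mu> Inside x0) \<sigma> n (\<lambda>t. em_H (vm t)) (\<lambda>t. em_H (v' t))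
      (\<lambda>t. em_beta (vm t)) (\<lambda>t. em_beta (v' t))"
    by (rule maxwell_normal_mode[OF vm n, of \<omega> "\<epsilon> Inside" "\<mu> Inside" x0 \<sigma>]) (use op_m in auto)
  obtain w' where w':
    "curl_div_mode (\<mu> Outside x0) (\<epsilon> Outside x0) \<sigma> (- n) (\<lambda>t. em_E (w t)) (\<lambda>t. em_E (w' t))
      (\<lambda>t. em_alpha (w t)) (\<lambda>t. em_alpha (w' t))"
    "curl_div_mode (\<epsilon> Outside x0) (\<mu> Outside x0) \<sigma> (- n) (\<lambda>t. em_H (w t)) (\<lambda>t. em_H (w' t))
      (\<lambda>t. em_beta (w t)) (\<lambda>t. em_beta (w' t))"
    by (rule maxwell_normal_mode[OF w(1), of "- n" \<omega> "\<epsilon> Outside" "\<mu> Outside" x0 \<sigma>])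
      (use n op_p in \<open>simp_all add: w(2)\<close>)
  have zero: "vm t = 0 \<and> w t = 0" if "t \<le> 0" for t
    using curl_div_mode_interface_eq_0[OF acc(2,1,2,1) \<sigma> n v'(1) w'(1) _ _ _ that]
      curl_div_mode_interface_eq_0[OF acc(1,2,1,2) \<sigma> n v'(2) w'(2) _ _ _ that] j
    by (simp add: em_eq_0_iff)
  show "(\<forall>t\<ge>0. vp t = 0) \<and> (\<forall>t\<le>0. vm t = 0)"
    using zero zero[of "- _"] by (auto simp: w_def)
qed

section \<open>Geometry of the domains\<close>

lemma exterior_normal_nonzero:
  assumes "exterior_normal D x0 n"
  shows "n \<noteq> 0"
proof -
  obtain T g where T: "orthogonal_transformation T" and n: "n = (1 / sqrt (1 + (norm g)\<^sup>2)) *\<^sub>R T (lift3 (- g) 1)"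
    using assms by (auto simp: exterior_normal_def lipschitz_chart_def)
  have "lift3 (- g) 1 $ 3 = 1"
    by (simp add: lift3_def)
  then have "lift3 (- g) 1 \<noteq> 0"
    by (metis zero_index zero_neq_one)
  then have "T (lift3 (- g) 1) \<noteq> 0"
    using orthogonal_transformation_norm[OF T, of "lift3 (- g) 1"] by auto
  moreover have "1 + (norm g)\<^sup>2 \<noteq> 0"
    by (smt (verit) zero_le_power2)
  ultimately show ?thesis by (simp add: n)
qed

text \<open>For a general open set, a frontier point may lie in the interior of the closure, as on a
  slit. In a Lipschitz chart the points strictly above the graph form an open set disjoint from D,
  hence from its closure, and x0 is approached vertically within it.\<close>

lemma lipschitz_boundary_frontier_exterior:
  assumes "lipschitz_boundary D" "x0 \<in> frontier D"
  shows "x0 \<in> closure (- closure D)"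
proof -
  obtain T \<phi> r h where chart: "lipschitz_chart D x0 T \<phi> r h"
    using assms by (auto simp: lipschitz_boundary_def)
  then obtain C where T: "orthogonal_transformation T" and r: "0 < r" and h: "0 < h"
    and lip: "C-lipschitz_on UNIV \<phi>" and \<phi>0: "\<phi> 0 = 0"
    and mem: "\<And>y s. norm y < r \<Longrightarrow> \<bar>s\<bar> < h \<Longrightarrow> x0 + T (lift3 y s) \<in> D \<longleftrightarrow> s < \<phi> y"
    unfolding lipschitz_chart_def by blast
  have linT: "linear T"
    using T by (rule orthogonal_transformation_linear)
  obtain T' where T': "linear T'" "\<And>z. T (T' z) = z" "\<And>z. T' (T z) = z"
  proof
    show "linear (inv T)"
      using T by (intro orthogonal_transformation_linear orthogonal_transformation_inv)
    show "T (inv T z) = z" "inv T (T z) = z" for z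
      using orthogonal_transformation_surj[OF T] orthogonal_transformation_inj[OF T]
      by (simp_all add: surj_f_inv_f)
  qed
  \<comment> \<open>\<open>y\<close> and \<open>s\<close> are the chart coordinates of an arbitrary
    point.\<close>
  define y :: "R3 \<Rightarrow> real^2" where "y z = vector [T' (z - x0) $ 1, T' (z - x0) $ 2]" for z
  define s where "s z = T' (z - x0) $ 3" for z
  have coords: "x0 + T (lift3 (y z) (s z)) = z" for z
  proof -
    have "lift3 (y z) (s z) = T' (z - x0)"
      by (simp add: lift3_def y_def s_def vec_eq_iff forall_3)
    then show ?thesis by (simp add: T')
  qed
  have contT': "continuous_on UNIV (\<lambda>z. T' (z - x0))"
    by (intro continuous_intros linear_continuous_on_compose[OF _ T'(1)])
  have y_alt: "y z = T' (z - x0) $ 1 *\<^sub>R axis 1 1 + T' (z - x0) $ 2 *\<^sub>R axis 2 1" for z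
    by (simp add: y_def vec_eq_iff forall_2 axis_def)
  have conty: "continuous_on UNIV y"
    unfolding y_alt[abs_def] by (intro continuous_intros contT')
  have conts: "continuous_on UNIV s"
    unfolding s_def by (intro continuous_intros contT')
  have "continuous_on UNIV \<phi>"
    using lip by (rule lipschitz_on_continuous_on)
  then have cont\<phi>: "continuous_on UNIV (\<lambda>z. \<phi> (y z))"
    by (rule continuous_on_compose2[OF _ conty]) simp
  \<comment> \<open>The inequality with \<phi> is strict to make \<open>U\<close> open.\<close>
  define U where "U = {z. norm (y z) < r} \<inter> {z. \<bar>s z\<bar> < h} \<inter> {z. \<phi> (y z) < s z}"
  have "open U"
    unfolding U_def by (intro open_Int open_Collect_less continuous_intros conty conts cont\<phi>)
  moreover have "U \<inter> D = {}"
    using mem coords by (fastforce simp: U_def)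
  ultimately have U: "U \<subseteq> - closure D"
    by (metis disjoint_eq_subset_Compl inf_commute open_Int_closure_eq_empty)
  have "((\<lambda>t. x0 + T (lift3 0 t)) \<longlongrightarrow> x0 + T (lift3 0 0)) (at_right 0)"
  proof -
    have lift: "lift3 0 t = t *\<^sub>R axis 3 1" for t
      by (simp add: lift3_def vec_eq_iff forall_3 axis_def)
    show ?thesis
      unfolding lift linear_scale[OF linT] by (intro tendsto_intros)
  qed
  moreover have "lift3 0 0 = 0"
    by (simp add: lift3_def vec_eq_iff forall_3)
  moreover have "\<forall>\<^sub>F t in at_right 0. x0 + T (lift3 0 t) \<in> U"
  proof -
    have "x0 + T (lift3 0 t) \<in> U" if "0 < t" "t < h" for t
    proof -
      have "y (x0 + T (lift3 0 t)) = 0" "s (x0 + T (lift3 0 t)) = t"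
        by (simp_all add: y_def s_def T' lift3_def vec_eq_iff forall_2)
      then show ?thesis
        using that r by (simp add: U_def \<phi>0)
    qed
    then show ?thesis
      using h by (auto simp: eventually_at_right_field)
  qed
  ultimately have "x0 \<in> closure U"
    using linear_0[OF linT] closure_subset[of U]
    by (intro Lim_in_closed_set[of "closure U" "\<lambda>t. x0 + T (lift3 0 t)" "at_right 0"])
      (auto elim: eventually_mono)
  then show ?thesis
    using closure_mono[OF U] by blast
qed

text \<open>Coefficients are controlled on the closed regions, so each frontier point must be placed
  in the right closures. The outer frontier avoids \<open>closure \<Omega>m\<close>, whose
  complement is open; the inner frontier lies in the open set \<Omega> and, in the Lipschitz case,
  is a limit of exterior points of \<open>\<Omega>m\<close>.\<close>

lemma frontier_subset_closure_region:
  assumes "open \<Omega>" "closure \<Omega>m \<subseteq> \<Omega>"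
  shows "frontier \<Omega> \<subseteq> closure (region \<Omega> \<Omega>m Outside)"
    and "frontier \<Omega>m \<subseteq> closure (region \<Omega> \<Omega>m Inside)"
    and "lipschitz_boundary \<Omega>m \<Longrightarrow> frontier \<Omega>m \<subseteq> closure (region \<Omega> \<Omega>m Outside)"
proof -
  have "frontier \<Omega> \<subseteq> closure \<Omega> \<inter> - closure \<Omega>m"
    using assms by (auto simp: frontier_def interior_open)
  also have "\<dots> \<subseteq> closure (\<Omega> \<inter> - closure \<Omega>m)"
    using open_Int_closure_subset[OF open_Compl[OF closed_closure], of \<Omega>m \<Omega>] by (simp add: Int_commute)
  finally show "frontier \<Omega> \<subseteq> closure (region \<Omega> \<Omega>m Outside)"
    by (simp add: region_def Diff_eq)
  show "frontier \<Omega>m \<subseteq> closure (region \<Omega> \<Omega>m Inside)"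
    by (auto simp: region_def frontier_def)
  assume "lipschitz_boundary \<Omega>m"
  then have "frontier \<Omega>m \<subseteq> \<Omega> \<inter> closure (- closure \<Omega>m)"
    using lipschitz_boundary_frontier_exterior assms(2) by (auto simp: frontier_def)
  also have "\<dots> \<subseteq> closure (\<Omega> \<inter> - closure \<Omega>m)"
    by (rule open_Int_closure_subset[OF assms(1)])
  finally show "frontier \<Omega>m \<subseteq> closure (region \<Omega> \<Omega>m Outside)"
    by (simp add: region_def Diff_eq)
qed

theorem theorem2p1:
  fixes \<Omega> \<Omega>m :: "(real^3) set" and \<omega> :: complex
    and \<epsilon> \<mu> :: "side \<Rightarrow> real^3 \<Rightarrow> complex^3^3"
    and E\<Gamma> H\<Gamma> E0 :: "real^3 \<Rightarrow> complex^3"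
    and D\<Gamma> \<beta>\<Gamma> B\<Gamma> \<alpha>\<Gamma> B0 \<beta>0 :: "real^3 \<Rightarrow> complex"
  assumes "bounded_domain \<Omega>" and "bounded_domain \<Omega>m" and "closure \<Omega>m \<subseteq> \<Omega>"
    and "lipschitz_boundary \<Omega>" and "lipschitz_boundary \<Omega>m"
    and "admissible_coefficient \<Omega> \<Omega>m \<epsilon>" and "admissible_coefficient \<Omega> \<Omega>m \<mu>"
    and "E\<Gamma> \<in> Hhalf_boundary \<Omega>m" and "D\<Gamma> \<in> Hhalf_boundary \<Omega>m" and "\<beta>\<Gamma> \<in> Hhalf_boundary \<Omega>m"
    and "H\<Gamma> \<in> Hhalf_boundary \<Omega>m" and "B\<Gamma> \<in> Hhalf_boundary \<Omega>m" and "\<alpha>\<Gamma> \<in> Hhalf_boundary \<Omega>m"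
    and "E0 \<in> Hhalf_boundary \<Omega>" and "B0 \<in> Hhalf_boundary \<Omega>" and "\<beta>0 \<in> Hhalf_boundary \<Omega>"
  shows "elliptic_problem (maxwell_problem \<Omega> \<Omega>m \<omega> \<epsilon> \<mu> E\<Gamma> D\<Gamma> \<beta>\<Gamma> H\<Gamma> B\<Gamma> \<alpha>\<Gamma> E0 B0 \<beta>0)"
proof -
  let ?P = "maxwell_problem \<Omega> \<Omega>m \<omega> \<epsilon> \<mu> E\<Gamma> D\<Gamma> \<beta>\<Gamma> H\<Gamma> B\<Gamma> \<alpha>\<Gamma> E0 B0 \<beta>0"
  note acc = admissible_coefficient_accretive[OF assms(6)] admissible_coefficient_accretive[OF assms(7)]
  have "open \<Omega>"
    using assms(1) by (simp add: bounded_domain_def)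
  note frontier = frontier_subset_closure_region[OF this assms(3), THEN subsetD]
  have "elliptic_system ?P"
    unfolding elliptic_system_def
    by (auto simp: maxwell_problem_def intro!: maxwell_elliptic_symbol acc)
  moreover have "SL_boundary ?P x0 n" if "x0 \<in> frontier \<Omega>" "exterior_normal \<Omega> x0 n" for x0 n
    by (rule maxwell_SL_boundary[of _ \<omega> "\<epsilon> Outside" "\<mu> Outside"])
      (auto simp: maxwell_problem_def intro!: acc frontier(1) that exterior_normal_nonzero[OF that(2)])
  moreover have "SL_interface ?P x0 n" if "x0 \<in> frontier \<Omega>m" "exterior_normal \<Omega>m x0 n" for x0 n
  proof (rule maxwell_SL_interface[of _ \<omega> \<epsilon> \<mu>])
    \<comment> \<open>At the interface the coefficients of both sides are frozen, so x0 must lie in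
      both closures.\<close>
    have "x0 \<in> closure (region \<Omega> \<Omega>m s)" for s
      using frontier(2)[OF that(1)] frontier(3)[OF assms(5) that(1)] by (cases s) auto
    then show "accretive (\<epsilon> s x0)" "accretive (\<mu> s x0)" for s
      by (rule acc)+
  qed (auto simp: maxwell_problem_def exterior_normal_nonzero[OF that(2)])
  ultimately show ?thesis
    by (simp add: elliptic_problem_def maxwell_problem_def)
qed

end
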